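(* Let $b$ be a Bloch function and let $(z_n)_{n\in\mathbb{N}}$ be a sequence in $\mathbb{D}$ satisfying the Carleson condition $\sup_{z\in\mathbb{D}}\sum_{n}(1-\rho^2(z,z_n))<\infty$. Then: (i) there exists $\lambda>0$ such that $$\sup_{z\in\mathbb{D}}\sup_{r\in(0,1)}\sum_{n:\,\rho(z,z_n)<r}\exp\!\left(\frac{\lambda|b(z_n)-b(z)|^2}{-\log(1-r^2)}\right)(1-\rho^2(z,z_n))<\infty;$$ (ii) there exist $\lambda>0$ and $C>0$ such that for every $z\in\mathbb{D}$ and every $t>0$, $$\#\left\{n\in\mathbb{N}:\ \exp\!\left(\frac{\lambda|b(z_n)-b(z)|^2}{-\log(1-\rho^2(z,z_n))}\right)(1-\rho^2(z,z_n))>t\right\}\le\frac{C}{t},$$ with the convention that the exponential factor equals $1$ when $z_n=z$.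
   Context: $\mathbb{D}$ is the open unit disc. The Bloch space $\mathcal{B}$ is the space of holomorphic $b$ on $\mathbb{D}$ with $\|b\|_{\mathcal{B}}=|b(0)|+\sup_{z\in\mathbb{D}}|b'(z)|(1-|z|^2)<\infty$. The pseudo-hyperbolic distance is $\rho(z,w)=\left|\frac{w-z}{1-\bar w z}\right|$. *)

theory Defs
  imports "HOL-Complex_Analysis.Complex_Analysis"
begin

definition pseudo_hyp :: "complex \<Rightarrow> complex \<Rightarrow> real" where
  "pseudo_hyp z w = cmod ((w - z) / (1 - cnj w * z))"

definition bloch :: "(complex \<Rightarrow> complex) \<Rightarrow> bool" where
  "bloch b \<longleftrightarrow> b holomorphic_on ball 0 1 \<and>
     (\<exists>M. \<forall>z\<in>ball 0 1. cmod (deriv b z) * (1 - (cmod z)\<^sup>2) \<le> M)"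

definition carleson_seq :: "(nat \<Rightarrow> complex) \<Rightarrow> bool" where
  "carleson_seq zs \<longleftrightarrow> (\<exists>M. \<forall>z\<in>ball 0 1.
     summable (\<lambda>n. 1 - (pseudo_hyp z (zs n))\<^sup>2) \<and>
     (\<Sum>n. 1 - (pseudo_hyp z (zs n))\<^sup>2) \<le> M)"

end

theory Submission
  imports Defs
begin

text \<open>
  A disc automorphism moves the base point to 0, so \<open>b\<close> becomes a Bloch function \<open>g\<close> with \<open>g(0) = 0\<close>,
  the points become \<open>w\<^sub>n\<close> and the weights \<open>p\<^sub>n = 1 - |w\<^sub>n|\<^sup>2\<close>. The sum of \<open>p\<^sub>n |g(w\<^sub>n)|\<^sup>2\<^sup>k\<close> over
  \<open>|w\<^sub>n|\<^sup>2 \<le> s\<close> is controlled by the Hardy norm of \<open>g\<^sup>k\<close> on the slightly larger disc of squared radius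
  \<open>R = (1 + s)/2\<close> (Carleson embedding), and that norm is at most \<open>k! B\<^sup>2\<^sup>k (- ln (1 - R))\<^sup>k\<close>, because
  \<open>N\<^sub>k(x) = \<Sum>|c\<^sub>j|\<^sup>2 x\<^sup>j\<close>, with \<open>c\<^sub>j\<close> the Taylor coefficients of \<open>g\<^sup>k\<close>, satisfies
  \<open>(x N\<^sub>k')' \<le> k\<^sup>2 B\<^sup>2 N\<^sub>k\<^sub>-\<^sub>1 / (1 - x)\<^sup>2\<close>. Summing the exponential series gives (i).
  For (ii), the points with \<open>p\<^sub>n > t\<close> or \<open>p\<^sub>n \<ge> 1/4\<close> are counted directly; the others are split into
  dyadic shells, on each of which Chebyshev's inequality for the square of the exponential factor
  and (i) give a geometrically decaying count.
\<close>

subsection \<open>Schur test for the squared Szego kernel\<close>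

text \<open>This identity ties the Euclidean distance to the Szego denominator. It is the source
  both of the bound on \<open>cmod (z - w)\<close> and of the formula for
  \<open>1 - (pseudo_hyp z w)\<^sup>2\<close>.\<close>

lemma cmod_one_minus_sq:
  "(cmod (1 - cnj w * z))\<^sup>2 = (cmod (z - w))\<^sup>2 + (1 - (cmod z)\<^sup>2) * (1 - (cmod w)\<^sup>2)"
  by (simp only: cmod_power2) (simp add: power2_eq_square algebra_simps)

lemma cmod_diff_le_one_minus:
  assumes "cmod z \<le> 1" "cmod w \<le> 1"
  shows "cmod (z - w) \<le> cmod (1 - cnj w * z)"
proof -
  have "(1 - (cmod z)\<^sup>2) * (1 - (cmod w)\<^sup>2) \<ge> 0"
    using assms by (intro mult_nonneg_nonneg) (auto simp: power_le_one)
  then have "(cmod (z - w))\<^sup>2 \<le> (cmod (1 - cnj w * z))\<^sup>2"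
    using cmod_one_minus_sq[of w z] by linarith
  then show ?thesis by (rule power2_le_imp_le) simp
qed

text \<open>
  The kernel \<open>|1 - conj(w) z|\<close> obeys the triangle inequality (the pseudo-hyperbolic distance is
  below 1); this replaces all harmonic analysis in the embedding theorem.
\<close>
lemma one_minus_triangle:
  assumes "cmod z \<le> 1" "cmod w \<le> 1" "cmod u \<le> 1"
  shows "cmod (1 - cnj u * w) \<le> cmod (1 - cnj u * z) + cmod (1 - cnj w * z)"
proof -
  have "1 - cnj u * w = (1 - cnj u * z) + cnj u * (z - w)" by (simp add: algebra_simps)
  then have "cmod (1 - cnj u * w) \<le> cmod (1 - cnj u * z) + cmod (cnj u * (z - w))"
    by (metis norm_triangle_ineq)
  also have "cmod (cnj u * (z - w)) \<le> 1 * cmod (z - w)"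
    unfolding norm_mult using assms by (intro mult_right_mono) auto
  also have "1 * cmod (z - w) \<le> cmod (1 - cnj w * z)"
    using cmod_diff_le_one_minus[OF assms(1,2)] by simp
  finally show ?thesis by simp
qed

lemma one_minus_pos:
  assumes "cmod z < 1" "cmod w < 1"
  shows "cmod (1 - cnj w * z) > 0"
proof -
  have "cmod (cnj w * z) < 1"
    using assms mult_strict_mono[of "cmod w" 1 "cmod z" 1] by (simp add: norm_mult)
  then show ?thesis by auto
qed

text \<open>The squared modulus of the Szego kernel. For points of the disc, multiplying it by
  \<open>1 - (cmod z)\<^sup>2\<close> and \<open>1 - (cmod w)\<^sup>2\<close> gives
  \<open>1 - (pseudo_hyp z w)\<^sup>2\<close>, the term of the Carleson sums.\<close>

definition kern :: "complex \<Rightarrow> complex \<Rightarrow> real" where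
  "kern z w = 1 / (cmod (1 - cnj w * z))\<^sup>2"

lemma kern_sym: "kern z w = kern w z"
proof -
  have "cmod (1 - cnj w * z) = cmod (cnj (1 - cnj w * z))" by (simp only: complex_mod_cnj)
  then show ?thesis by (simp add: kern_def mult.commute)
qed

lemma kern_nonneg [simp]: "kern z w \<ge> 0" by (simp add: kern_def)

text \<open>Squaring the triangle inequality costs a factor 2; division by the three squared
  denominators turns it into a statement on kernels. Two kernels issuing from \<open>z\<close> are
  thereby replaced by chains through \<open>w\<close> and \<open>u\<close>, which is what an iterate
  of the kernel operator contains.\<close>

lemma kern_mult_le:
  assumes "cmod z < 1" "cmod w < 1" "cmod u < 1"
  shows "kern z w * kern z u \<le> 2 * (kern z w * kern w u + kern z u * kern u w)"
proof -
  define A where "A = cmod (1 - cnj w * z)"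
  define B where "B = cmod (1 - cnj u * z)"
  define D where "D = cmod (1 - cnj u * w)"
  have pos: "A > 0" "B > 0" "D > 0"
    unfolding A_def B_def D_def using assms by (blast intro: one_minus_pos)+
  have "D \<le> B + A"
    unfolding A_def B_def D_def using assms by (intro one_minus_triangle) auto
  then have "D\<^sup>2 \<le> (B + A)\<^sup>2" using pos by (intro power_mono) auto
  also have "\<dots> \<le> 2 * (A\<^sup>2 + B\<^sup>2)"
    using zero_le_power2[of "A - B"] by (simp add: power2_eq_square algebra_simps)
  finally have *: "D\<^sup>2 \<le> 2 * (A\<^sup>2 + B\<^sup>2)" .
  have "1 / A\<^sup>2 * (1 / B\<^sup>2) = D\<^sup>2 / (A\<^sup>2 * B\<^sup>2 * D\<^sup>2)" using pos by (simp add: field_simps)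
  also have "\<dots> \<le> 2 * (A\<^sup>2 + B\<^sup>2) / (A\<^sup>2 * B\<^sup>2 * D\<^sup>2)"
    using * pos by (intro divide_right_mono) auto
  also have "\<dots> = 2 * (1 / A\<^sup>2 * (1 / D\<^sup>2) + 1 / B\<^sup>2 * (1 / D\<^sup>2))" using pos by (simp add: field_simps)
  finally show ?thesis
    unfolding kern_sym[of u w] unfolding kern_def A_def B_def D_def .
qed

text \<open>
  The kernel inequality gives \<open>(Sf)\<^sup>2 \<le> 4 S(f Sf)\<close> pointwise; integrating, the hypothesis enters
  only through the adjoint of \<open>S\<close> applied to 1, and Cauchy-Schwarz closes the estimate.
\<close>
lemma schur_bound:
  fixes w :: "'i \<Rightarrow> complex" and f :: "'i \<Rightarrow> real" and p :: "'i \<Rightarrow> real"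
  assumes fin: "finite I"
    and w: "\<And>n. n \<in> I \<Longrightarrow> cmod (w n) < 1"
    and p: "\<And>n. n \<in> I \<Longrightarrow> p n \<ge> 0"
    and f: "\<And>n. n \<in> I \<Longrightarrow> f n \<ge> 0"
    and M: "\<And>m. m \<in> I \<Longrightarrow> (\<Sum>n\<in>I. p n * p m * kern (w n) (w m)) \<le> M" and M0: "M \<ge> 0"
  shows "(\<Sum>n\<in>I. \<Sum>m\<in>I. p n * f n * (p m)\<^sup>2 * f m * kern (w n) (w m)) \<le> 4 * M * (\<Sum>n\<in>I. p n * (f n)\<^sup>2)"
proof -
  define S where "S h n = (\<Sum>m\<in>I. kern (w n) (w m) * ((p m)\<^sup>2 * h m))" for h n
  have S0: "S f n \<ge> 0" for n unfolding S_def using f by (intro sum_nonneg) auto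
  have sq: "(S f n)\<^sup>2 \<le> 4 * S (\<lambda>m. f m * S f m) n" if n: "n \<in> I" for n
  proof -
    let ?k = "\<lambda>i j. kern (w i) (w j)"
    let ?a = "\<lambda>m. (p m)\<^sup>2 * f m"
    have a0: "?a m \<ge> 0" if "m \<in> I" for m using f that by simp
    have e: "(\<Sum>m\<in>I. \<Sum>l\<in>I. ?a m * ?a l * (?k n m * ?k m l)) = S (\<lambda>m. f m * S f m) n"
      unfolding S_def by (simp add: sum_distrib_left mult_ac power2_eq_square)
    \<comment> \<open>The two chains of the kernel inequality differ only by the names of the
      summation indices, so they contribute equally.\<close>
    have e': "(\<Sum>m\<in>I. \<Sum>l\<in>I. ?a m * ?a l * (?k n l * ?k l m)) = S (\<lambda>m. f m * S f m) n"
      unfolding e[symmetric] by (subst sum.swap) (simp add: mult_ac)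
    have "(S f n)\<^sup>2 = (\<Sum>m\<in>I. \<Sum>l\<in>I. ?a m * ?a l * (?k n m * ?k n l))"
      unfolding S_def power2_eq_square sum_product by (simp add: mult_ac)
    also have "\<dots> \<le> (\<Sum>m\<in>I. \<Sum>l\<in>I. ?a m * ?a l * (2 * (?k n m * ?k m l + ?k n l * ?k l m)))"
      using n by (intro sum_mono mult_left_mono kern_mult_le w mult_nonneg_nonneg a0) auto
    also have "\<dots> = 2 * ((\<Sum>m\<in>I. \<Sum>l\<in>I. ?a m * ?a l * (?k n m * ?k m l)) +
        (\<Sum>m\<in>I. \<Sum>l\<in>I. ?a m * ?a l * (?k n l * ?k l m)))"
      by (simp add: sum.distrib sum_distrib_left distrib_left mult_ac)
    also have "\<dots> = 4 * S (\<lambda>m. f m * S f m) n" unfolding e e' by simp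
    finally show ?thesis .
  qed
  define X where "X = (\<Sum>n\<in>I. p n * (f n)\<^sup>2)"
  define Y where "Y = (\<Sum>n\<in>I. p n * (S f n)\<^sup>2)"
  define Z where "Z = (\<Sum>n\<in>I. p n * (f n * S f n))"
  have nn: "X \<ge> 0" "Y \<ge> 0" "Z \<ge> 0"
    unfolding X_def Y_def Z_def using p f S0 by (auto intro!: sum_nonneg)
  have "Y \<le> (\<Sum>n\<in>I. p n * (4 * S (\<lambda>m. f m * S f m) n))"
    unfolding Y_def using sq p by (intro sum_mono mult_left_mono) auto
  also have "\<dots> = (\<Sum>n\<in>I. \<Sum>m\<in>I. 4 * (p m * (f m * S f m)) * (p n * p m * kern (w n) (w m)))"
    unfolding S_def[of "\<lambda>m. f m * S f m"] by (simp add: sum_distrib_left mult_ac power2_eq_square)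
  \<comment> \<open>With the sums exchanged, one factor of the weight \<open>(p m)\<^sup>2\<close>
    stays with the kernel, so that the inner sum over \<open>n\<close> is the one bounded by
    \<open>M\<close>.\<close>
  also have "\<dots> = (\<Sum>m\<in>I. 4 * (p m * (f m * S f m)) * (\<Sum>n\<in>I. p n * p m * kern (w n) (w m)))"
    by (subst sum.swap) (simp add: sum_distrib_left)
  also have "\<dots> \<le> (\<Sum>m\<in>I. 4 * (p m * (f m * S f m)) * M)"
    using p f S0 M by (intro sum_mono mult_left_mono) auto
  also have "\<dots> = 4 * M * Z" by (simp add: Z_def sum_distrib_left mult_ac)
  finally have Y: "Y \<le> 4 * M * Z" .
  have "Z\<^sup>2 = (\<Sum>n\<in>I. (sqrt (p n) * f n) * (sqrt (p n) * S f n))\<^sup>2"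
    unfolding Z_def using p by (intro arg_cong[where f = "\<lambda>x. x\<^sup>2"] sum.cong) auto
  also have "\<dots> \<le> (\<Sum>n\<in>I. (sqrt (p n) * f n)\<^sup>2) * (\<Sum>n\<in>I. (sqrt (p n) * S f n)\<^sup>2)"
    by (rule Cauchy_Schwarz_ineq_sum)
  also have "\<dots> = X * Y" unfolding X_def Y_def using p by (simp add: power_mult_distrib)
  finally have "Z\<^sup>2 \<le> X * (4 * M * Z)" using Y nn by (meson mult_left_mono order_trans)
  then have "Z * Z \<le> (4 * M * X) * Z" by (simp add: power2_eq_square mult_ac)
  then have "Z \<le> 4 * M * X"
    using nn M0 by (cases "Z = 0") (auto simp: mult_le_cancel_right)
  moreover have "Z = (\<Sum>n\<in>I. \<Sum>m\<in>I. p n * f n * (p m)\<^sup>2 * f m * kern (w n) (w m))"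
    unfolding Z_def S_def by (simp add: sum_distrib_left mult_ac)
  ultimately show ?thesis unfolding X_def by simp
qed

subsection \<open>Parseval's identity and coefficient sums\<close>

text \<open>Orthogonality of the characters. The frequency is an integer because the double sum in
  Parseval's identity produces differences of exponents.\<close>

lemma has_integral_cis_period:
  fixes k :: int
  shows "((\<lambda>t. cis (real_of_int k * t)) has_integral (if k = 0 then of_real (2 * pi) else 0)) {0..2*pi}"
proof (cases "k = 0")
  case True
  have "((\<lambda>t::real. 1::complex) has_integral of_real (2 * pi)) {0..2*pi}"
    using has_integral_const_real[of "1::complex" 0 "2*pi"] by (simp add: scaleR_conv_of_real)
  then show ?thesis using True by simp
next
  case False
  have "((\<lambda>t. cis (real_of_int k * t)) has_integral
      (cis (real_of_int k * (2*pi)) / (\<i> * of_int k) - cis (real_of_int k * 0) / (\<i> * of_int k))) {0..2*pi}"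
  proof (rule fundamental_theorem_of_calculus)
    fix t :: real
    have "((\<lambda>z. exp (\<i> * of_int k * z) / (\<i> * of_int k)) has_field_derivative exp (\<i> * of_int k * of_real t)) (at (of_real t))"
      using False by (auto intro!: derivative_eq_intros)
    then have "((\<lambda>t. exp (\<i> * of_int k * of_real t) / (\<i> * of_int k)) has_vector_derivative exp (\<i> * of_int k * of_real t)) (at t within {0..2*pi})"
      by (rule has_vector_derivative_real_field)
    then show "((\<lambda>t. cis (real_of_int k * t) / (\<i> * of_int k)) has_vector_derivative cis (real_of_int k * t)) (at t within {0..2*pi})"
      by (simp add: cis_conv_exp mult_ac)
  qed simp
  moreover have "cis (real_of_int k * (2*pi)) = 1"
    using cis_multiple_2pi[of "real_of_int k"] by (simp add: mult_ac)
  ultimately show ?thesis using False by simp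
qed

lemma conv_radius_ge_1I:
  fixes c :: "nat \<Rightarrow> complex"
  assumes "\<And>z. cmod z < 1 \<Longrightarrow> (\<lambda>j. c j * z ^ j) sums F z"
  shows "conv_radius c \<ge> 1"
proof (rule conv_radius_geI_ex)
  fix r :: real assume "0 < r" "ereal r < 1"
  then show "\<exists>z. norm z = r \<and> summable (\<lambda>j. c j * z ^ j)"
    using assms[of "of_real r"] by (intro exI[of _ "of_real r"]) (auto simp: sums_iff)
qed

text \<open>Taylor polynomials converge uniformly on the circle, so the integrals of their squared
  moduli converge to that of \<open>F\<close>. A single \<open>J\<close> records integrability,
  summability and the equality of the two values.\<close>

lemma parseval_circle:
  fixes c :: "nat \<Rightarrow> complex" and F :: "complex \<Rightarrow> complex"
  assumes F: "\<And>z. cmod z < 1 \<Longrightarrow> (\<lambda>j. c j * z ^ j) sums F z"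
    and r: "0 \<le> r" "r < 1"
  obtains J where "((\<lambda>t. (cmod (F (of_real r * cis t)))\<^sup>2) has_integral (2 * pi * J)) {0..2*pi}"
    and "(\<lambda>j. (cmod (c j))\<^sup>2 * (r\<^sup>2) ^ j) sums J"
proof -
  define T where "T n t = (\<Sum>j<n. c j * (of_real r * cis t) ^ j)" for n t
  define G where "G t = F (of_real r * cis t)" for t
  have rad: "ereal r < conv_radius c"
    using conv_radius_ge_1I[OF F] r by (metis ereal_less(3) less_le_trans one_ereal_def)
  have sumeq: "suminf (\<lambda>i. c i * (x - 0) ^ i) = F x" if "x \<in> cball 0 r" for x
    using F[of x] that r by (simp add: sums_iff)
  have "uniform_limit (cball 0 r) (\<lambda>n x. \<Sum>i<n. c i * (x - 0) ^ i) (\<lambda>x. suminf (\<lambda>i. c i * (x - 0) ^ i)) sequentially"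
    by (rule powser_uniform_limit[OF rad])
  then have "uniform_limit (cball 0 r) (\<lambda>n x. \<Sum>i<n. c i * x ^ i) F sequentially"
    using sumeq by (subst (asm) uniform_limit_cong'[of _ _ "\<lambda>n x. \<Sum>i<n. c i * x ^ i" _ F]) auto
  then have UL: "uniform_limit {0..2*pi} T G sequentially"
    unfolding T_def G_def
    by (rule uniform_limit_compose') (use r in \<open>auto simp: norm_mult\<close>)
  have cT: "continuous_on {0..2*pi} (T n)" for n
    unfolding T_def by (intro continuous_intros)
  have cG: "continuous_on {0..2*pi} G"
    by (rule uniform_limit_theorem[OF _ UL]) (intro always_eventually allI cT, simp)
  have bG: "bounded (G ` {0..2*pi})"
    by (intro compact_imp_bounded compact_continuous_image cG) auto
  have UL': "uniform_limit {0..2*pi} (\<lambda>n t. cnj (T n t)) (\<lambda>t. cnj (G t)) sequentially"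
    by (rule bounded_linear.uniform_limit[OF bounded_linear_cnj UL])
  have bG': "bounded ((\<lambda>t. cnj (G t)) ` {0..2*pi})"
    using bG by (auto simp: bounded_iff)
  \<comment> \<open>The squared modulus is written as a product with the conjugate: products of
    uniform limits are uniform limits when the limit functions are bounded.\<close>
  have U: "uniform_limit {0..2*pi} (\<lambda>n t. T n t * cnj (T n t)) (\<lambda>t. G t * cnj (G t)) sequentially"
    by (rule uniform_lim_mult[OF UL UL' bG bG'])
  have cTT: "continuous_on {0..2*pi} (\<lambda>t. T n t * cnj (T n t))" for n
    by (intro continuous_on_mult continuous_on_cnj cT)
  obtain I L where I: "\<And>n. ((\<lambda>t. T n t * cnj (T n t)) has_integral I n) {0..2*pi}"
    and L: "((\<lambda>t. G t * cnj (G t)) has_integral L) {0..2*pi}" and lim: "I \<longlonglongrightarrow> L"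
    by (rule uniform_limit_integral[OF U cTT sequentially_bot]) blast
  \<comment> \<open>For the Taylor polynomials orthogonality leaves only the diagonal of the double
    sum.\<close>
  have In: "I n = of_real (2 * pi * (\<Sum>j<n. (cmod (c j))\<^sup>2 * (r\<^sup>2) ^ j))" for n
  proof -
    have T2: "T n t * cnj (T n t) = (\<Sum>j<n. \<Sum>l<n. (c j * cnj (c l) * of_real (r ^ (j + l))) * cis (real_of_int (int j - int l) * t))" for t
    proof -
      have "cis t ^ j * cnj (cis t ^ l) = cis (real_of_int (int j - int l) * t)" for j l
        by (simp add: Complex.DeMoivre cis_cnj cis_mult algebra_simps)
      then show ?thesis
        unfolding T_def cnj_sum sum_product
        by (intro sum.cong refl) (simp add: power_mult_distrib power_add mult_ac)
    qed
    have "((\<lambda>t. T n t * cnj (T n t)) has_integral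
       (\<Sum>j<n. \<Sum>l<n. (c j * cnj (c l) * of_real (r ^ (j + l))) * (if int j - int l = 0 then of_real (2 * pi) else 0))) {0..2*pi}"
      unfolding T2 by (intro has_integral_sum has_integral_mult_right has_integral_cis_period) auto
    then have "I n = (\<Sum>j<n. \<Sum>l<n. (c j * cnj (c l) * of_real (r ^ (j + l))) * (if int j - int l = 0 then of_real (2 * pi) else 0))"
      using I has_integral_unique by blast
    also have "\<dots> = (\<Sum>j<n. c j * cnj (c j) * of_real (r ^ (j + j)) * of_real (2 * pi))"
    proof (intro sum.cong refl)
      fix j assume j: "j \<in> {..<n}"
      let ?h = "\<lambda>l. c j * cnj (c l) * of_real (r ^ (j + l)) * of_real (2 * pi)"
      have "(\<Sum>l<n. (c j * cnj (c l) * of_real (r ^ (j + l))) * (if int j - int l = 0 then of_real (2 * pi) else 0))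
          = (\<Sum>l<n. if j = l then ?h l else 0)"
        by (intro sum.cong) auto
      also have "\<dots> = ?h j" using j by simp
      finally show "(\<Sum>l<n. (c j * cnj (c l) * of_real (r ^ (j + l))) * (if int j - int l = 0 then of_real (2 * pi) else 0)) = ?h j" .
    qed
    also have "\<dots> = of_real (2 * pi * (\<Sum>j<n. (cmod (c j))\<^sup>2 * (r\<^sup>2) ^ j))"
    proof -
      have "c j * cnj (c j) * of_real (r ^ (j + j)) * of_real (2 * pi)
          = complex_of_real (2 * pi * ((cmod (c j))\<^sup>2 * (r\<^sup>2) ^ j))" for j
        unfolding complex_norm_square[symmetric] of_real_mult[symmetric]
        by (simp only: power_mult[symmetric] mult_2[symmetric] mult_ac)
      then show ?thesis by (simp only: sum_distrib_left of_real_sum)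
    qed
    finally show ?thesis .
  qed
  have "(\<lambda>n. 2 * pi * (\<Sum>j<n. (cmod (c j))\<^sup>2 * (r\<^sup>2) ^ j)) \<longlonglongrightarrow> Re L"
    using tendsto_Re[OF lim] unfolding In by simp
  then have "(\<lambda>n. 2 * pi * (\<Sum>j<n. (cmod (c j))\<^sup>2 * (r\<^sup>2) ^ j) / (2 * pi)) \<longlonglongrightarrow> Re L / (2 * pi)"
    by (intro tendsto_divide) auto
  then have 1: "(\<lambda>j. (cmod (c j))\<^sup>2 * (r\<^sup>2) ^ j) sums (Re L / (2 * pi))"
    unfolding sums_def by simp
  have "((Re \<circ> (\<lambda>t. G t * cnj (G t))) has_integral Re L) {0..2*pi}"
    by (rule has_integral_linear[OF L bounded_linear_Re])
  moreover have "Re \<circ> (\<lambda>t. G t * cnj (G t)) = (\<lambda>t. (cmod (G t))\<^sup>2)"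
    by (auto simp: fun_eq_iff complex_norm_square[symmetric] simp flip: of_real_power)
  ultimately have 2: "((\<lambda>t. (cmod (F (of_real r * cis t)))\<^sup>2) has_integral (2 * pi * (Re L / (2 * pi)))) {0..2*pi}"
    unfolding G_def by simp
  show ?thesis by (rule that[OF 2 1])
qed

text \<open>Parseval's identity at radius \<open>sqrt \<bar>x\<bar>\<close> gives absolute
  convergence. Negative \<open>x\<close> is included so that the sum can be differentiated at 0 as a
  real power series.\<close>

lemma summable_coeff_square:
  fixes c :: "nat \<Rightarrow> complex"
  assumes F: "\<And>z. cmod z < 1 \<Longrightarrow> (\<lambda>j. c j * z ^ j) sums F z" and x: "\<bar>x\<bar> < 1"
  shows "summable (\<lambda>j. (cmod (c j))\<^sup>2 * x ^ j)"
proof -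
  have "sqrt \<bar>x\<bar> < 1" using x by simp
  then obtain J where "(\<lambda>j. (cmod (c j))\<^sup>2 * ((sqrt \<bar>x\<bar>)\<^sup>2) ^ j) sums J"
    using parseval_circle[OF F, of "sqrt \<bar>x\<bar>"] by auto
  then have "summable (\<lambda>j. norm ((cmod (c j))\<^sup>2 * x ^ j))"
    by (simp add: sums_iff abs_mult power_abs)
  then show ?thesis by (rule summable_norm_cancel)
qed

text \<open>By Parseval both sums are means over the circle of squared radius \<open>x\<close>, so a
  pointwise comparison there is enough.\<close>

lemma coeff_square_sum_mono:
  fixes c d :: "nat \<Rightarrow> complex"
  assumes F: "\<And>z. cmod z < 1 \<Longrightarrow> (\<lambda>j. c j * z ^ j) sums F z"
    and G: "\<And>z. cmod z < 1 \<Longrightarrow> (\<lambda>j. d j * z ^ j) sums G z"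
    and x: "0 \<le> x" "x < 1" and K: "K \<ge> 0"
    and le: "\<And>z. (cmod z)\<^sup>2 = x \<Longrightarrow> (cmod (F z))\<^sup>2 \<le> K * (cmod (G z))\<^sup>2"
  shows "(\<Sum>j. (cmod (c j))\<^sup>2 * x ^ j) \<le> K * (\<Sum>j. (cmod (d j))\<^sup>2 * x ^ j)"
proof -
  define r where "r = sqrt x"
  have r: "0 \<le> r" "r < 1" "r\<^sup>2 = x" using x by (auto simp: r_def)
  obtain J where J: "((\<lambda>t. (cmod (F (of_real r * cis t)))\<^sup>2) has_integral (2 * pi * J)) {0..2*pi}"
    "(\<lambda>j. (cmod (c j))\<^sup>2 * (r\<^sup>2) ^ j) sums J" using parseval_circle[OF F r(1,2)] by blast
  obtain L where L: "((\<lambda>t. (cmod (G (of_real r * cis t)))\<^sup>2) has_integral (2 * pi * L)) {0..2*pi}"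
    "(\<lambda>j. (cmod (d j))\<^sup>2 * (r\<^sup>2) ^ j) sums L" using parseval_circle[OF G r(1,2)] by blast
  have "2 * pi * J \<le> K * (2 * pi * L)"
    by (rule has_integral_le[OF J(1) has_integral_mult_right[OF L(1), of K]])
       (rule le, use r in \<open>simp add: norm_mult\<close>)
  then have "J \<le> K * L" by (simp add: mult_ac)
  then show ?thesis using J(2) L(2) r(3) by (simp add: sums_iff)
qed

section \<open>Differentiation of power series and a logarithmic growth bound\<close>

lemma power_series_deriv_sums:
  fixes c :: "nat \<Rightarrow> complex"
  assumes F: "\<And>z. cmod z < 1 \<Longrightarrow> (\<lambda>j. c j * z ^ j) sums F z" and z: "cmod z < 1"
  shows "(\<lambda>j. diffs c j * z ^ j) sums deriv F z"
proof -
  have sm: "\<And>z. cmod z < 1 \<Longrightarrow> summable (\<lambda>j. c j * z ^ j)" using F by (auto simp: sums_iff)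
  have "((\<lambda>z. \<Sum>j. c j * z ^ j) has_field_derivative (\<Sum>j. diffs c j * z ^ j)) (at z)"
    by (rule termdiffs_strong'[OF sm z])
  then have "(F has_field_derivative (\<Sum>j. diffs c j * z ^ j)) (at z)"
    by (rule has_field_derivative_transform_within_open[of _ _ _ "ball 0 1"])
       (use z F in \<open>auto simp: sums_iff\<close>)
  then have "deriv F z = (\<Sum>j. diffs c j * z ^ j)" by (rule DERIV_imp_deriv)
  moreover have "summable (\<lambda>j. diffs c j * z ^ j)"
    by (rule termdiff_converges[OF z sm])
  ultimately show ?thesis by (simp add: sums_iff)
qed

text \<open>Let \<open>N\<close> be the sum of the series. The hypothesis bounds the derivative of
  \<open>x * N' x\<close>, which is a quarter of the Laplacian of \<open>N\<close> evaluated at the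
  squared modulus. Two integrations from 0 give the claim: the first bounds \<open>x * N' x\<close>
  by \<open>K * l x ^ m * (x / (1 - x))\<close>, and after cancelling \<open>x\<close> the second
  raises the power of the logarithm by one and produces the factor
  \<open>1 / real (Suc m)\<close>.\<close>

lemma power_series_log_bound:
  fixes a :: "nat \<Rightarrow> real"
  assumes sm: "\<And>x. \<bar>x\<bar> < 1 \<Longrightarrow> summable (\<lambda>j. a j * x ^ j)" and a0: "a 0 = 0" and K: "K \<ge> 0"
    and P: "\<And>x. 0 \<le> x \<Longrightarrow> x < 1 \<Longrightarrow>
      (\<Sum>j. diffs (\<lambda>j. real j * a j) j * x ^ j) \<le> K * (- ln (1 - x)) ^ m / (1 - x)\<^sup>2"
    and x: "0 \<le> x" "x < 1"
  shows "(\<Sum>j. a j * x ^ j) \<le> K / real (Suc m) * (- ln (1 - x)) ^ Suc m"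
proof -
  define N where "N x = (\<Sum>j. a j * x ^ j)" for x
  define N' where "N' x = (\<Sum>j. diffs a j * x ^ j)" for x
  define Q where "Q x = (\<Sum>j. (real j * a j) * x ^ j)" for x
  define Q' where "Q' x = (\<Sum>j. diffs (\<lambda>j. real j * a j) j * x ^ j)" for x
  have smd: "summable (\<lambda>j. diffs a j * x ^ j)" if "\<bar>x\<bar> < 1" for x
    by (rule termdiff_converges[of _ 1]) (use sm that in auto)
  have shift: "(\<lambda>j. (real (Suc j) * a (Suc j)) * x ^ Suc j) sums (x * N' x)" if "\<bar>x\<bar> < 1" for x
    using sums_mult[OF summable_sums[OF smd[OF that]], of x]
    by (simp add: N'_def diffs_def mult_ac)
  have Qs: "(\<lambda>j. (real j * a j) * x ^ j) sums (x * N' x)" if "\<bar>x\<bar> < 1" for x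
    using shift[OF that] by (subst (asm) sums_Suc_iff) simp
  have QN: "Q x = x * N' x" if "\<bar>x\<bar> < 1" for x
    using Qs[OF that] by (simp add: Q_def sums_iff)
  have dN: "(N has_real_derivative N' x) (at x)" if "\<bar>x\<bar> < 1" for x
    unfolding N_def N'_def by (rule termdiffs_strong'[of 1]) (use sm that in auto)
  have dQ: "(Q has_real_derivative Q' x) (at x)" if "\<bar>x\<bar> < 1" for x
    unfolding Q_def Q'_def by (rule termdiffs_strong'[of 1]) (use Qs that in \<open>auto simp: sums_iff\<close>)
  define l where "l x = - ln (1 - x)" for x :: real
  have l0: "l x \<ge> 0" if "0 \<le> x" "x < 1" for x using that by (simp add: l_def)
  have dl: "(l has_real_derivative 1 / (1 - x)) (at x)" if "x < 1" for x
    unfolding l_def using that by (auto intro!: derivative_eq_intros simp: field_simps)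
  have Qle: "Q x \<le> K * l x ^ m * (x / (1 - x))" if x: "0 \<le> x" "x < 1" for x
  proof -
    define q where "q x = x / (1 - x)" for x :: real
    let ?D = "\<lambda>x. K * l x ^ m * q x - Q x"
    have "?D 0 \<le> ?D x"
    proof (rule DERIV_nonneg_imp_nondecreasing[OF x(1)])
      fix t assume t: "0 \<le> t" "t \<le> x"
      then have t1: "t < 1" using x by simp
      have "(q has_real_derivative 1 / (1 - t)\<^sup>2) (at t)"
        unfolding q_def using t1 by (auto intro!: derivative_eq_intros simp: field_simps power2_eq_square)
      from DERIV_diff[OF DERIV_mult[OF DERIV_cmult[OF DERIV_power[OF dl[OF t1], of m], of K] this] dQ]
      have "(?D has_real_derivative
          (K * (real m * (1 / (1 - t)) * l t ^ (m - Suc 0)) * q t + K * l t ^ m * (1 / (1 - t)\<^sup>2) - Q' t)) (at t)"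
        using t t1 by (simp add: mult_ac)
      moreover have "Q' t \<le> K * l t ^ m * (1 / (1 - t)\<^sup>2)"
        using P[OF t(1) t1] by (simp add: Q'_def l_def)
      \<comment> \<open>This term comes from differentiating \<open>l ^ m\<close> and is dropped.
        For \<open>m = 0\<close> the truncated exponent \<open>m - Suc 0\<close> does no harm
        because of the factor \<open>real m\<close>.\<close>
      moreover have "K * (real m * (1 / (1 - t)) * l t ^ (m - Suc 0)) * q t \<ge> 0"
        unfolding q_def using t t1 K l0[OF t(1) t1] by (intro mult_nonneg_nonneg divide_nonneg_nonneg) auto
      ultimately show "\<exists>y. (?D has_real_derivative y) (at t) \<and> 0 \<le> y"
        by (intro exI conjI) (assumption, linarith)
    qed
    then show ?thesis using QN[of 0] by (simp add: q_def)
  qed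
  let ?E = "\<lambda>x. K / real (Suc m) * l x ^ Suc m - N x"
  have "?E 0 \<le> ?E x"
  \<comment> \<open>Only interior points are tested, since the bound on \<open>N'\<close> arises by
    cancelling \<open>t\<close>; continuity covers the endpoints.\<close>
  proof (rule DERIV_nonneg_imp_increasing_open[OF x(1)])
    fix t assume t: "0 < t" "t < x"
    then have t1: "t < 1" using x by simp
    from t have "\<bar>t\<bar> < 1" using t1 by simp
    from DERIV_diff[OF DERIV_cmult[OF DERIV_power_Suc[OF dl[OF t1], of m], of "K / real (Suc m)"] dN[OF this]]
    have "(?E has_real_derivative (K / real (Suc m) * (real (Suc m) * (1 / (1 - t) * l t ^ m)) - N' t)) (at t)"
      by (simp only: of_nat_Suc)
    moreover have "N' t \<le> K / real (Suc m) * (real (Suc m) * (1 / (1 - t) * l t ^ m))"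
    proof -
      have "t * N' t \<le> t * (K * l t ^ m / (1 - t))"
        using Qle[of t] QN[of t] t t1 by (simp add: mult_ac)
      then have "N' t \<le> K * l t ^ m / (1 - t)" using t by (simp only: mult_le_cancel_left_pos)
      then show ?thesis by (simp del: of_nat_Suc)
    qed
    ultimately show "\<exists>y. (?E has_real_derivative y) (at t) \<and> 0 \<le> y"
      by (intro exI conjI) (assumption, linarith)
  next
    have "isCont ?E t" if "0 \<le> t" "t \<le> x" for t
      using that x by (intro continuous_intros DERIV_isCont[OF dl] DERIV_isCont[OF dN]) auto
    then show "continuous_on {0..x} ?E" by (intro continuous_at_imp_continuous_on) auto
  qed
  moreover have "N 0 = 0" "l 0 = 0"
    using a0 by (auto simp: N_def l_def)
  ultimately show ?thesis unfolding N_def l_def by simp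
qed

subsection \<open>Carleson embedding\<close>

lemma Re_kernel_pos:
  assumes "cmod u < 1"
  shows "Re (1 / (1 - u)) > 0"
proof -
  have "Re u < 1" using assms complex_Re_le_cmod[of u] by linarith
  moreover have "Re (1 / (1 - u)) = (1 - Re u) / (cmod (1 - u))\<^sup>2"
    by (simp add: Re_divide cmod_power2)
  moreover have "1 - u \<noteq> 0" using assms by auto
  ultimately show ?thesis by (simp add: divide_pos_pos)
qed

text \<open>The real part of the Szego kernel rescaled to squared radius \<open>R\<close> is
  compared with \<open>kern\<close> of the original disc. The gain over the modulus is the factor
  \<open>(1 - (cmod z)\<^sup>2) + (1 - (cmod w)\<^sup>2)\<close>, which supplies the extra weight
  for the Schur test.\<close>

lemma Re_kernel_le:
  assumes z: "(cmod z)\<^sup>2 \<le> s" and w: "(cmod w)\<^sup>2 \<le> s" and s: "s < 1"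
  defines "R \<equiv> (1 + s) / 2"
  shows "cmod (cnj w * z / of_real R) < 1"
    and "Re (1 / (1 - cnj w * z / of_real R)) \<le> 2 * ((1 - (cmod z)\<^sup>2) + (1 - (cmod w)\<^sup>2)) * kern z w + 1/2"
proof -
  define t where "t = cnj w * z"
  define u where "u = t / of_real R"
  have s0: "s \<ge> 0" using z zero_le_power2[of "cmod z"] by linarith
  have R: "0 < R" "s < R" "R < 1" using s s0 by (auto simp: R_def)
  have "(cmod t)\<^sup>2 \<le> s * s"
    unfolding t_def norm_mult power_mult_distrib using z w s0 by (intro mult_mono) auto
  then have t: "cmod t \<le> s" using s0 by (metis power2_eq_square power2_le_imp_le)
  have u1: "cmod u < 1" using t R by (simp add: u_def norm_divide)
  then show "cmod (cnj w * z / of_real R) < 1" by (simp add: u_def t_def)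
  define a where "a = (cmod z)\<^sup>2 / R"
  define b where "b = (cmod w)\<^sup>2 / R"
  have ab: "a < 1" "b < 1" using z w R by (auto simp: a_def b_def)
  have nu: "(cmod u)\<^sup>2 = a * b"
    by (simp add: u_def t_def a_def b_def norm_mult norm_divide power_mult_distrib power_divide power2_eq_square)
  have e: "(cmod (1 - u))\<^sup>2 = 1 - 2 * Re u + (cmod u)\<^sup>2"
    by (simp only: cmod_power2) (simp add: power2_eq_square algebra_simps)
  have "(1 - a) * (1 - b) \<ge> 0" using ab by simp
  \<comment> \<open>As \<open>(cmod u)\<^sup>2 = a * b\<close>, the inequality is exactly a
    rearrangement of \<open>(1 - a) * (1 - b) \<ge> 0\<close>.\<close>
  then have key: "1 - Re u \<le> ((1 - a) + (1 - b)) / 2 + (cmod (1 - u))\<^sup>2 / 2"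
    unfolding e nu by (simp add: field_simps)
  have pos: "cmod (1 - u) > 0" using u1 by auto
  \<comment> \<open>The radius \<open>R\<close> is the midpoint of \<open>s\<close> and 1, so
    \<open>1 - R = R - s\<close>, and this is at most the distance from \<open>R\<close> to
    \<open>t\<close>. Rescaling thus changes the denominator by a bounded factor.\<close>
  have "cmod (1 - t) \<le> cmod (of_real R - t) + cmod (of_real (1 - R))"
    using norm_triangle_ineq[of "of_real R - t" "of_real (1 - R)"] by simp
  also have "cmod (of_real (1 - R)) = R - s" unfolding norm_of_real using s by (simp add: R_def field_simps)
  also have "R - s \<le> cmod (of_real R - t)"
    using norm_triangle_ineq2[of "of_real R" t] t R by simp
  finally have "cmod (1 - t) \<le> 2 * cmod (of_real R - t)" by simp
  also have "of_real R - t = of_real R * (1 - u)" using R by (simp add: u_def field_simps)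
  finally have "cmod (1 - t) \<le> 2 * R * cmod (1 - u)" using R by (simp add: norm_mult)
  then have "(cmod (1 - t))\<^sup>2 \<le> (2 * R * cmod (1 - u))\<^sup>2" by (intro power_mono) auto
  then have le: "(cmod (1 - t))\<^sup>2 \<le> 4 * R\<^sup>2 * (cmod (1 - u))\<^sup>2" by (simp add: power_mult_distrib)
  have "cmod t < 1" using t s by linarith
  then have t0: "cmod (1 - t) > 0" by auto
  have inv: "1 / (cmod (1 - u))\<^sup>2 \<le> 4 * R\<^sup>2 * kern z w"
    using le pos t0 unfolding kern_def t_def[symmetric] by (simp add: field_simps)
  have "Re (1 / (1 - u)) = (1 - Re u) / (cmod (1 - u))\<^sup>2"
    by (simp add: Re_divide cmod_power2)
  also have "\<dots> \<le> (((1 - a) + (1 - b)) / 2 + (cmod (1 - u))\<^sup>2 / 2) / (cmod (1 - u))\<^sup>2"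
    using key by (intro divide_right_mono) auto
  also have "\<dots> = ((1 - a) + (1 - b)) / 2 * (1 / (cmod (1 - u))\<^sup>2) + 1/2"
    using pos by (simp add: field_simps)
  also have "\<dots> \<le> ((1 - a) + (1 - b)) / 2 * (4 * R\<^sup>2 * kern z w) + 1/2"
    using ab inv by (intro add_right_mono mult_left_mono) auto
  also have "\<dots> = 2 * (R * kern z w) * (R * (1 - a) + R * (1 - b)) + 1/2"
    by (simp add: power2_eq_square field_simps)
  also have "R * (1 - a) = R - (cmod z)\<^sup>2" using R by (auto simp: a_def field_simps)
  also have "R * (1 - b) = R - (cmod w)\<^sup>2" using R by (auto simp: b_def field_simps)
  also have "2 * (R * kern z w) * ((R - (cmod z)\<^sup>2) + (R - (cmod w)\<^sup>2)) + 1/2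
      \<le> 2 * (1 * kern z w) * ((1 - (cmod z)\<^sup>2) + (1 - (cmod w)\<^sup>2)) + 1/2"
    using R z w by (intro add_right_mono mult_mono mult_left_mono) auto
  finally show "Re (1 / (1 - cnj w * z / of_real R)) \<le> 2 * ((1 - (cmod z)\<^sup>2) + (1 - (cmod w)\<^sup>2)) * kern z w + 1/2"
    by (simp add: u_def t_def algebra_simps)
qed

text \<open>
  For real coefficients only the real part of the Szego kernel matters. It is positive and at most
  a symmetrised Poisson-type kernel, to which the Schur test applies.
\<close>
lemma gram_form_bound:
  fixes w :: "'i \<Rightarrow> complex" and h :: "'i \<Rightarrow> real"
  assumes fin: "finite I"
    and w: "\<And>n. n \<in> I \<Longrightarrow> (cmod (w n))\<^sup>2 \<le> s" and s: "s < 1"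
  defines "p \<equiv> \<lambda>n. 1 - (cmod (w n))\<^sup>2"
  assumes M: "\<And>m. m \<in> I \<Longrightarrow> (\<Sum>n\<in>I. p n * p m * kern (w n) (w m)) \<le> M"
    and M': "(\<Sum>n\<in>I. p n) \<le> M"
  shows "(\<Sum>n\<in>I. \<Sum>m\<in>I. (p n * h n) * (p m * h m) * Re (1 / (1 - cnj (w m) * w n / of_real ((1 + s) / 2))))
     \<le> 17 * M * (\<Sum>n\<in>I. p n * (h n)\<^sup>2)"
proof -
  have w1: "cmod (w n) < 1" if "n \<in> I" for n
    using w[OF that] s by (intro power2_less_imp_less[of _ 1]) auto
  have p0: "p n \<ge> 0" if "n \<in> I" for n using w[OF that] s by (simp add: p_def)
  have M0: "M \<ge> 0" using M' sum_nonneg[of I p] p0 by auto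
  define f where "f n = \<bar>h n\<bar>" for n
  define X where "X = (\<Sum>n\<in>I. p n * (h n)\<^sup>2)"
  have X0: "X \<ge> 0" unfolding X_def using p0 by (intro sum_nonneg) auto
  have "(\<Sum>n\<in>I. \<Sum>m\<in>I. (p n * h n) * (p m * h m) * Re (1 / (1 - cnj (w m) * w n / of_real ((1 + s) / 2))))
    \<le> (\<Sum>n\<in>I. \<Sum>m\<in>I. (p n * f n) * (p m * f m) * (2 * (p n + p m) * kern (w n) (w m) + 1/2))"
  proof (intro sum_mono)
    fix n m assume nm: "n \<in> I" "m \<in> I"
    let ?K = "Re (1 / (1 - cnj (w m) * w n / of_real ((1 + s) / 2)))"
    note K = Re_kernel_le[OF w[OF nm(1)] w[OF nm(2)] s]
    have "0 < ?K" using Re_kernel_pos[OF K(1)] .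
    have "(p n * h n) * (p m * h m) * ?K \<le> \<bar>(p n * h n) * (p m * h m)\<bar> * ?K"
      using \<open>0 < ?K\<close> by (intro mult_right_mono) auto
    also have "\<bar>(p n * h n) * (p m * h m)\<bar> = (p n * f n) * (p m * f m)"
      using p0 nm by (simp add: abs_mult f_def)
    also have "(p n * f n) * (p m * f m) * ?K \<le> (p n * f n) * (p m * f m) * (2 * (p n + p m) * kern (w n) (w m) + 1/2)"
      using K(2) p0 nm by (intro mult_left_mono) (auto simp: p_def f_def)
    finally show "(p n * h n) * (p m * h m) * ?K \<le> (p n * f n) * (p m * f m) * (2 * (p n + p m) * kern (w n) (w m) + 1/2)" .
  qed
  \<comment> \<open>Splitting \<open>p n + p m\<close> gives two Schur forms, equal after exchange
    of the indices; the constant 1/2 leaves the square of a single sum.\<close>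
  also have "\<dots> = 2 * (\<Sum>n\<in>I. \<Sum>m\<in>I. p n * f n * (p m)\<^sup>2 * f m * kern (w n) (w m))
      + 2 * (\<Sum>n\<in>I. \<Sum>m\<in>I. p m * f m * (p n)\<^sup>2 * f n * kern (w m) (w n))
      + (\<Sum>n\<in>I. p n * f n)\<^sup>2 / 2"
    unfolding power2_eq_square[of "sum _ _"] sum_product
    by (simp add: sum.distrib sum_distrib_left algebra_simps power2_eq_square kern_sym sum_divide_distrib)
  also have "(\<Sum>n\<in>I. \<Sum>m\<in>I. p m * f m * (p n)\<^sup>2 * f n * kern (w m) (w n))
      = (\<Sum>n\<in>I. \<Sum>m\<in>I. p n * f n * (p m)\<^sup>2 * f m * kern (w n) (w m))"
    by (rule sum.swap)
  also have "(\<Sum>n\<in>I. \<Sum>m\<in>I. p n * f n * (p m)\<^sup>2 * f m * kern (w n) (w m)) \<le> 4 * M * (\<Sum>n\<in>I. p n * (f n)\<^sup>2)"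
    by (rule schur_bound[OF fin w1 p0 _ M M0]) (auto simp: f_def)
  also have "(\<Sum>n\<in>I. p n * (f n)\<^sup>2) = X" by (simp add: X_def f_def)
  also have "(\<Sum>n\<in>I. p n * f n)\<^sup>2 \<le> M * X"
  proof -
    have "(\<Sum>n\<in>I. p n * f n)\<^sup>2 = (\<Sum>n\<in>I. sqrt (p n) * (sqrt (p n) * f n))\<^sup>2"
      using p0 by (intro arg_cong[where f = "\<lambda>x. x\<^sup>2"] sum.cong) auto
    also have "\<dots> \<le> (\<Sum>n\<in>I. (sqrt (p n))\<^sup>2) * (\<Sum>n\<in>I. (sqrt (p n) * f n)\<^sup>2)"
      by (rule Cauchy_Schwarz_ineq_sum)
    also have "\<dots> = (\<Sum>n\<in>I. p n) * X" using p0 by (simp add: power_mult_distrib X_def f_def)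
    also have "\<dots> \<le> M * X" using M' X0 by (intro mult_right_mono)
    finally show ?thesis .
  qed
  \<comment> \<open>The total is 16.5 times \<open>M * X\<close>, rounded up to 17.\<close>
  finally have "(\<Sum>n\<in>I. \<Sum>m\<in>I. (p n * h n) * (p m * h m) * Re (1 / (1 - cnj (w m) * w n / of_real ((1 + s) / 2))))
     \<le> 2 * (4 * M * X) + 2 * (4 * M * X) + M * X / 2" by simp
  moreover have "M * X \<ge> 0" using M0 X0 by simp
  ultimately show ?thesis unfolding X_def[symmetric] by linarith
qed

text \<open>A combination of values of the series pairs \<open>c j\<close> with the power sums
  \<open>S j\<close>. Cauchy-Schwarz with weights \<open>R ^ j\<close> and their inverses separates
  the two, and the geometric series sums the second factor to the Gram form of the Szego kernel. The
  coefficients \<open>a\<close> being real, only real parts of that kernel survive.\<close>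

lemma evaluation_duality:
  fixes c :: "nat \<Rightarrow> complex" and a :: "'i \<Rightarrow> real"
  assumes F: "\<And>n. n \<in> I \<Longrightarrow> (\<lambda>j. c j * w n ^ j) sums F n"
    and R: "R > 0" and sm: "summable (\<lambda>j. (cmod (c j))\<^sup>2 * R ^ j)"
    and w: "\<And>n m. n \<in> I \<Longrightarrow> m \<in> I \<Longrightarrow> cmod (cnj (w m) * w n / of_real R) < 1"
  shows "(cmod (\<Sum>n\<in>I. of_real (a n) * F n))\<^sup>2 \<le> (\<Sum>j. (cmod (c j))\<^sup>2 * R ^ j) *
     (\<Sum>n\<in>I. \<Sum>m\<in>I. a n * a m * Re (1 / (1 - cnj (w m) * w n / of_real R)))"
proof -
  define S where "S j = (\<Sum>n\<in>I. of_real (a n) * w n ^ j)" for j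
  have lim1: "(\<lambda>J. (cmod (\<Sum>j<J. c j * S j))\<^sup>2) \<longlonglongrightarrow> (cmod (\<Sum>n\<in>I. of_real (a n) * F n))\<^sup>2"
  proof -
    have "(\<lambda>j. \<Sum>n\<in>I. of_real (a n) * (c j * w n ^ j)) sums (\<Sum>n\<in>I. of_real (a n) * F n)"
      by (intro sums_sum sums_mult F)
    then have "(\<lambda>j. c j * S j) sums (\<Sum>n\<in>I. of_real (a n) * F n)"
      by (simp add: S_def sum_distrib_left mult_ac)
    then show ?thesis unfolding sums_def by (intro tendsto_intros)
  qed
  have lim2: "(\<lambda>J. \<Sum>j<J. (cmod (c j))\<^sup>2 * R ^ j) \<longlonglongrightarrow> (\<Sum>j. (cmod (c j))\<^sup>2 * R ^ j)"
    using summable_sums[OF sm] by (simp add: sums_def)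
  have lim3: "(\<lambda>J. \<Sum>j<J. (cmod (S j))\<^sup>2 / R ^ j) \<longlonglongrightarrow>
     (\<Sum>n\<in>I. \<Sum>m\<in>I. a n * a m * Re (1 / (1 - cnj (w m) * w n / of_real R)))"
  proof -
    have "(\<lambda>j. \<Sum>n\<in>I. \<Sum>m\<in>I. a n * a m * Re ((cnj (w m) * w n / of_real R) ^ j)) sums
        (\<Sum>n\<in>I. \<Sum>m\<in>I. a n * a m * Re (1 / (1 - cnj (w m) * w n / of_real R)))"
      by (intro sums_sum sums_mult sums_Re geometric_sums w)
    moreover have "(\<Sum>n\<in>I. \<Sum>m\<in>I. a n * a m * Re ((cnj (w m) * w n / of_real R) ^ j)) = (cmod (S j))\<^sup>2 / R ^ j" for j
    proof -
      have "complex_of_real ((cmod (S j))\<^sup>2) = S j * cnj (S j)" by (rule complex_norm_square)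
      also have "\<dots> = (\<Sum>n\<in>I. \<Sum>m\<in>I. of_real (a n * a m) * (cnj (w m) * w n) ^ j)"
        unfolding S_def cnj_sum sum_product by (intro sum.cong refl) (simp add: power_mult_distrib mult_ac)
      finally have "Re (complex_of_real ((cmod (S j))\<^sup>2)) = Re (\<Sum>n\<in>I. \<Sum>m\<in>I. of_real (a n * a m) * (cnj (w m) * w n) ^ j)"
        by (rule arg_cong)
      then have *: "(cmod (S j))\<^sup>2 = (\<Sum>n\<in>I. \<Sum>m\<in>I. a n * a m * Re ((cnj (w m) * w n) ^ j))"
        by (simp only: Re_sum Re_complex_of_real times_complex.sel Im_complex_of_real) simp
      have "Re ((cnj (w m) * w n / of_real R) ^ j) = Re ((cnj (w m) * w n) ^ j) / R ^ j" for n m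
        by (simp only: power_divide of_real_power[symmetric] Re_divide_of_real)
      then show ?thesis unfolding * by (simp add: sum_divide_distrib)
    qed
    ultimately show ?thesis by (simp add: sums_def)
  qed
  have "(cmod (\<Sum>j<J. c j * S j))\<^sup>2 \<le> (\<Sum>j<J. (cmod (c j))\<^sup>2 * R ^ j) * (\<Sum>j<J. (cmod (S j))\<^sup>2 / R ^ j)" for J
  proof -
    have "cmod (\<Sum>j<J. c j * S j) \<le> (\<Sum>j<J. (cmod (c j) * sqrt R ^ j) * (cmod (S j) / sqrt R ^ j))"
      using R by (intro order_trans[OF norm_sum] sum_mono) (simp add: norm_mult)
    then have "(cmod (\<Sum>j<J. c j * S j))\<^sup>2 \<le> (\<Sum>j<J. (cmod (c j) * sqrt R ^ j) * (cmod (S j) / sqrt R ^ j))\<^sup>2"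
      by (intro power_mono) auto
    also have "\<dots> \<le> (\<Sum>j<J. (cmod (c j) * sqrt R ^ j)\<^sup>2) * (\<Sum>j<J. (cmod (S j) / sqrt R ^ j)\<^sup>2)"
      by (rule Cauchy_Schwarz_ineq_sum)
    also have "\<dots> = (\<Sum>j<J. (cmod (c j))\<^sup>2 * R ^ j) * (\<Sum>j<J. (cmod (S j))\<^sup>2 / R ^ j)"
    proof -
      have "(sqrt R ^ j)\<^sup>2 = R ^ j" for j using R by (metis less_imp_le power_commutes power_mult mult.commute real_sqrt_pow2)
      then show ?thesis by (simp add: power_mult_distrib power_divide)
    qed
    finally show ?thesis .
  qed
  then show ?thesis
    by (intro LIMSEQ_le[OF lim1 tendsto_mult[OF lim2 lim3]]) auto
qed

text \<open>Duality is tested on the coefficients \<open>p n * Re (F n)\<close>, for which the real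
  part of the combination is the sum \<open>X\<close> itself. The Gram bound returns a multiple of
  \<open>X\<close>, and one factor \<open>X\<close> cancels.\<close>

lemma carleson_embedding_Re:
  fixes c :: "nat \<Rightarrow> complex"
  assumes fin: "finite I"
    and w: "\<And>n. n \<in> I \<Longrightarrow> (cmod (w n))\<^sup>2 \<le> s" and s: "0 \<le> s" "s < 1"
  defines "p \<equiv> \<lambda>n. 1 - (cmod (w n))\<^sup>2"
  assumes M: "\<And>m. m \<in> I \<Longrightarrow> (\<Sum>n\<in>I. p n * p m * kern (w n) (w m)) \<le> M"
    and M': "(\<Sum>n\<in>I. p n) \<le> M"
    and F: "\<And>n. n \<in> I \<Longrightarrow> (\<lambda>j. c j * w n ^ j) sums F n"
    and sm: "summable (\<lambda>j. (cmod (c j))\<^sup>2 * ((1 + s) / 2) ^ j)"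
  shows "(\<Sum>n\<in>I. p n * (Re (F n))\<^sup>2) \<le> 17 * M * (\<Sum>j. (cmod (c j))\<^sup>2 * ((1 + s) / 2) ^ j)"
proof -
  define X where "X = (\<Sum>n\<in>I. p n * (Re (F n))\<^sup>2)"
  define N where "N = (\<Sum>j. (cmod (c j))\<^sup>2 * ((1 + s) / 2) ^ j)"
  have p0: "p n \<ge> 0" if "n \<in> I" for n using w[OF that] s by (simp add: p_def)
  have M0: "M \<ge> 0" using M' sum_nonneg[of I p] p0 by auto
  have X0: "X \<ge> 0" unfolding X_def using p0 by (intro sum_nonneg) auto
  have N0: "N \<ge> 0" unfolding N_def using s by (intro suminf_nonneg sm) auto
  have "X = Re (\<Sum>n\<in>I. of_real (p n * Re (F n)) * F n)"
    by (simp add: X_def power2_eq_square mult_ac)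
  then have "X\<^sup>2 \<le> (cmod (\<Sum>n\<in>I. of_real (p n * Re (F n)) * F n))\<^sup>2"
    using X0 by (metis complex_Re_le_cmod power_mono)
  also have "\<dots> \<le> N * (\<Sum>n\<in>I. \<Sum>m\<in>I. (p n * Re (F n)) * (p m * Re (F m)) *
      Re (1 / (1 - cnj (w m) * w n / of_real ((1 + s) / 2))))"
    unfolding N_def
    by (rule evaluation_duality[OF F _ sm]) (use s Re_kernel_le(1)[OF w w s(2)] in auto)
  also have "\<dots> \<le> N * (17 * M * X)"
    unfolding X_def p_def
    by (intro mult_left_mono N0 gram_form_bound[OF fin w s(2)] M[unfolded p_def] M'[unfolded p_def])
  finally have "X * X \<le> (17 * M * N) * X" by (simp add: power2_eq_square mult_ac)
  then have "X \<le> 17 * M * N"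
    using X0 N0 M0 by (cases "X = 0") (auto simp: mult_le_cancel_right)
  then show ?thesis by (simp add: X_def N_def)
qed

text \<open>The real-part estimate is applied to \<open>F\<close> and to \<open>F\<close> times
  \<open>- \<i>\<close>, whose real part is the imaginary part of \<open>F\<close>; hence 34 is
  twice 17.\<close>

lemma carleson_embedding:
  fixes c :: "nat \<Rightarrow> complex"
  assumes fin: "finite I"
    and w: "\<And>n. n \<in> I \<Longrightarrow> (cmod (w n))\<^sup>2 \<le> s" and s: "0 \<le> s" "s < 1"
  defines "p \<equiv> \<lambda>n. 1 - (cmod (w n))\<^sup>2"
  assumes M: "\<And>m. m \<in> I \<Longrightarrow> (\<Sum>n\<in>I. p n * p m * kern (w n) (w m)) \<le> M"
    and M': "(\<Sum>n\<in>I. p n) \<le> M"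
    and F: "\<And>n. n \<in> I \<Longrightarrow> (\<lambda>j. c j * w n ^ j) sums F n"
    and sm: "summable (\<lambda>j. (cmod (c j))\<^sup>2 * ((1 + s) / 2) ^ j)"
  shows "(\<Sum>n\<in>I. p n * (cmod (F n))\<^sup>2) \<le> 34 * M * (\<Sum>j. (cmod (c j))\<^sup>2 * ((1 + s) / 2) ^ j)"
proof -
  have F': "(\<lambda>j. (- \<i> * c j) * w n ^ j) sums (- \<i> * F n)" if "n \<in> I" for n
    using sums_mult[OF F[OF that], of "- \<i>"] by (simp add: mult_ac)
  have sm': "summable (\<lambda>j. (cmod (- \<i> * c j))\<^sup>2 * ((1 + s) / 2) ^ j)" using sm by (simp add: norm_mult)
  note 1 = carleson_embedding_Re[OF fin w s M[unfolded p_def] M'[unfolded p_def] F sm]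
  note 2 = carleson_embedding_Re[OF fin w s M[unfolded p_def] M'[unfolded p_def] F' sm']
  have "(\<Sum>n\<in>I. p n * (cmod (F n))\<^sup>2) = (\<Sum>n\<in>I. p n * (Re (F n))\<^sup>2) + (\<Sum>n\<in>I. p n * (Im (F n))\<^sup>2)"
    by (simp add: cmod_power2 distrib_left sum.distrib)
  then show ?thesis using 1 2 by (simp add: p_def norm_mult)
qed

subsection \<open>Exponential square integrability of Bloch functions\<close>

lemma disc_power_series:
  assumes "f holomorphic_on ball 0 1"
  obtains c where "\<And>z. cmod z < 1 \<Longrightarrow> (\<lambda>j. c j * z ^ j) sums f z"
proof (rule that[of "\<lambda>j. (deriv ^^ j) f 0 / fact j"])
  fix z :: complex assume "cmod z < 1"
  then show "(\<lambda>j. (deriv ^^ j) f 0 / fact j * z ^ j) sums f z"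
    using holomorphic_power_series[OF assms, of z] by simp
qed

text \<open>Induction on \<open>k\<close>: the Bloch bound controls the derivative of
  \<open>g ^ Suc k\<close> by \<open>g ^ k\<close> on each circle, Parseval turns this into a
  differential inequality for the squared-coefficient sums, and
  \<open>power_series_log_bound\<close> integrates it. The coefficients \<open>c\<close> vary in the
  induction, since each power has its own.\<close>

lemma bloch_power_moments:
  fixes g :: "complex \<Rightarrow> complex" and c :: "nat \<Rightarrow> complex"
  assumes hol: "g holomorphic_on ball 0 1" and g0: "g 0 = 0"
    and B: "\<And>z. cmod z < 1 \<Longrightarrow> cmod (deriv g z) * (1 - (cmod z)\<^sup>2) \<le> B"
    and x: "0 \<le> x" "x < 1"
    and c: "\<And>z. cmod z < 1 \<Longrightarrow> (\<lambda>j. c j * z ^ j) sums (g z ^ k)"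
  shows "(\<Sum>j. (cmod (c j))\<^sup>2 * x ^ j) \<le> fact k * B ^ (2 * k) * (- ln (1 - x)) ^ k"
  using x c
proof (induction k arbitrary: x c)
  case 0
  have "(\<lambda>j. (if j = 0 then 1 else 0) * z ^ j) sums (1 :: complex)" for z
  proof -
    have "(\<lambda>j. (if j = 0 then 1 else 0) * z ^ j) = (\<lambda>j. if j = 0 then 1 else 0)" by auto
    then show ?thesis using sums_single[of 0 "\<lambda>_. 1::complex"] by simp
  qed
  \<comment> \<open>The coefficients \<open>c\<close> are known only through the function they sum
    to; Parseval compares them with the explicit coefficients of the constant 1.\<close>
  then have "(\<Sum>j. (cmod (c j))\<^sup>2 * x ^ j) \<le> 1 * (\<Sum>j. (cmod (if j = 0 then 1 else 0))\<^sup>2 * x ^ j)"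
    using 0 by (intro coeff_square_sum_mono[of _ "\<lambda>z. g z ^ 0" _ "\<lambda>z. 1"]) auto
  also have "(\<lambda>j. (cmod (if j = 0 then 1 else 0))\<^sup>2 * x ^ j) = (\<lambda>j. if j = 0 then 1 else 0)"
    by (auto simp: fun_eq_iff)
  finally show ?case using sums_single[of 0 "\<lambda>_. 1::real"] by (simp add: sums_iff)
next
  case (Suc k)
  note c = Suc.prems(3)
  have B0: "B \<ge> 0" using B[of 0] by (auto intro: order_trans[OF norm_ge_zero])
  have "(\<lambda>z. g z ^ k) holomorphic_on ball 0 1" using hol by (intro holomorphic_intros)
  from disc_power_series[OF this]
  obtain d where d: "\<And>z. cmod z < 1 \<Longrightarrow> (\<lambda>j. d j * z ^ j) sums (g z ^ k)"
    by blast
  have der: "deriv (\<lambda>z. g z ^ Suc k) z = of_nat (Suc k) * g z ^ k * deriv g z" if "cmod z < 1" for z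
  proof (rule DERIV_imp_deriv)
    have "(g has_field_derivative deriv g z) (at z)"
      using hol that by (intro holomorphic_derivI[of _ "ball 0 1"]) auto
    from DERIV_power_Suc[OF this, of k]
    show "((\<lambda>z. g z ^ Suc k) has_field_derivative of_nat (Suc k) * g z ^ k * deriv g z) (at z)"
      by (simp add: mult_ac)
  qed
  \<comment> \<open>If \<open>N\<close> is the sum attached to \<open>c\<close>, the series of the
    derivative of \<open>x * N' x\<close> has as coefficients the squared moduli of the Taylor
    coefficients of the derivative.\<close>
  have sq: "diffs (\<lambda>j. real j * (cmod (c j))\<^sup>2) j = (cmod (diffs c j))\<^sup>2" for j
    by (simp add: diffs_def norm_mult power_mult_distrib power2_eq_square del: of_nat_Suc)
  have step: "(\<Sum>j. diffs (\<lambda>j. real j * (cmod (c j))\<^sup>2) j * y ^ j)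
      \<le> ((real (Suc k))\<^sup>2 * B\<^sup>2 * (fact k * B ^ (2 * k))) * (- ln (1 - y)) ^ k / (1 - y)\<^sup>2"
    if y: "0 \<le> y" "y < 1" for y
  proof -
    define K where "K = (real (Suc k))\<^sup>2 * B\<^sup>2 / (1 - y)\<^sup>2"
    have K0: "K \<ge> 0" by (simp add: K_def)
    have "(\<Sum>j. (cmod (diffs c j))\<^sup>2 * y ^ j) \<le> K * (\<Sum>j. (cmod (d j))\<^sup>2 * y ^ j)"
    proof (rule coeff_square_sum_mono[OF power_series_deriv_sums[OF c] d y K0])
      fix z assume z: "(cmod z)\<^sup>2 = y"
      then have z1: "cmod z < 1" using y by (intro power2_less_imp_less[of _ 1]) auto
      have "cmod (deriv g z) \<le> B / (1 - y)" using B[OF z1] z y by (simp add: field_simps)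
      then have "(cmod (deriv g z))\<^sup>2 \<le> (B / (1 - y))\<^sup>2" by (intro power_mono) auto
      then have "(cmod (g z ^ k))\<^sup>2 * (real (Suc k))\<^sup>2 * (cmod (deriv g z))\<^sup>2
          \<le> (cmod (g z ^ k))\<^sup>2 * (real (Suc k))\<^sup>2 * (B / (1 - y))\<^sup>2" by (intro mult_left_mono) auto
      then show "(cmod (deriv (\<lambda>z. g z ^ Suc k) z))\<^sup>2 \<le> K * (cmod (g z ^ k))\<^sup>2"
        unfolding der[OF z1] K_def norm_mult norm_of_nat by (simp add: power_mult_distrib power_divide mult_ac)
    qed auto
    also have "\<dots> \<le> K * (fact k * B ^ (2 * k) * (- ln (1 - y)) ^ k)"
      by (intro mult_left_mono Suc.IH K0 y d)
    finally show ?thesis unfolding sq by (simp add: K_def mult_ac)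
  qed
  have "c 0 = 0"
    using c[of 0] g0 powser_sums_zero_iff[of c 0] by (simp add: sums_iff)
  then have "(\<Sum>j. (cmod (c j))\<^sup>2 * x ^ j)
      \<le> ((real (Suc k))\<^sup>2 * B\<^sup>2 * (fact k * B ^ (2 * k))) / real (Suc k) * (- ln (1 - x)) ^ Suc k"
    using Suc.prems(1,2) B0
    by (intro power_series_log_bound step summable_coeff_square[OF c]) auto
  \<comment> \<open>One factor \<open>real (Suc k)\<close> is absorbed by integrating the power of
    the logarithm; the other extends the factorial.\<close>
  also have "((real (Suc k))\<^sup>2 * B\<^sup>2 * (fact k * B ^ (2 * k))) / real (Suc k) = fact (Suc k) * B ^ (2 * Suc k)"
    by (simp add: power2_eq_square field_simps del: of_nat_Suc)
  finally show ?case .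
qed

section \<open>From moment bounds to exponential sums\<close>

lemma ln_one_minus_ge: "0 \<le> s \<Longrightarrow> s < 1 \<Longrightarrow> s \<le> - ln (1 - s :: real)"
  using ln_le_minus_one[of "1 - s"] by simp

lemma bloch_growth_near_0:
  fixes g :: "complex \<Rightarrow> complex"
  assumes hol: "g holomorphic_on ball 0 1" and g0: "g 0 = 0"
    and B: "\<And>z. cmod z < 1 \<Longrightarrow> cmod (deriv g z) * (1 - (cmod z)\<^sup>2) \<le> B"
    and w: "(cmod w)\<^sup>2 \<le> s" and s: "s < 1"
  shows "cmod (g w) \<le> B / (1 - s) * cmod w"
proof -
  have s0: "s \<ge> 0" using w zero_le_power2[of "cmod w"] by linarith
  have sub: "z \<in> ball 0 1 \<and> (cmod z)\<^sup>2 \<le> s" if "z \<in> cball 0 (cmod w)" for z :: complex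
  proof -
    have "(cmod z)\<^sup>2 \<le> (cmod w)\<^sup>2" using that by (intro power_mono) auto
    then have "(cmod z)\<^sup>2 \<le> s" using w by linarith
    moreover from this have "cmod z < 1" using s by (intro power2_less_imp_less[of _ 1]) auto
    ultimately show ?thesis by simp
  qed
  have "cmod (g w - g 0) \<le> B / (1 - s) * cmod (w - 0)"
  proof (rule field_differentiable_bound[of "cball 0 (cmod w)" g "deriv g"])
    fix z :: complex assume z: "z \<in> cball 0 (cmod w)"
    have "(g has_field_derivative deriv g z) (at z)"
      using hol sub[OF z] by (intro holomorphic_derivI[of _ "ball 0 1"]) auto
    then show "(g has_field_derivative deriv g z) (at z within cball 0 (cmod w))"
      by (rule has_field_derivative_at_within)
    have "cmod (deriv g z) * (1 - s) \<le> cmod (deriv g z) * (1 - (cmod z)\<^sup>2)"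
      using sub[OF z] by (intro mult_left_mono) auto
    also have "\<dots> \<le> B" using B sub[OF z] by simp
    finally show "cmod (deriv g z) \<le> B / (1 - s)" using s by (simp add: field_simps)
  qed auto
  then show ?thesis using g0 by simp
qed

text \<open>Near 0 the logarithm in the denominator is only of order \<open>s\<close>, but linear
  growth of \<open>g\<close> makes the numerator of order \<open>s\<close> as well. This settles the
  range where \<open>s\<close> stays away from 1.\<close>

lemma bloch_square_le_log:
  fixes g :: "complex \<Rightarrow> complex"
  assumes hol: "g holomorphic_on ball 0 1" and g0: "g 0 = 0" and B0: "B > 0"
    and B: "\<And>z. cmod z < 1 \<Longrightarrow> cmod (deriv g z) * (1 - (cmod z)\<^sup>2) \<le> B"
    and w: "(cmod w)\<^sup>2 \<le> s" and s: "0 < s" "s < 1"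
  shows "(cmod (g w))\<^sup>2 / (- ln (1 - s)) \<le> (B / (1 - s))\<^sup>2"
proof -
  have "(cmod (g w))\<^sup>2 \<le> (B / (1 - s) * cmod w)\<^sup>2"
    using bloch_growth_near_0[OF hol g0 B w s(2)] by (intro power_mono) auto
  also have "\<dots> \<le> (B / (1 - s))\<^sup>2 * s" unfolding power_mult_distrib using w by (intro mult_left_mono) auto
  also have "\<dots> \<le> (B / (1 - s))\<^sup>2 * (- ln (1 - s))" using ln_one_minus_ge[of s] s by (intro mult_left_mono) auto
  finally show ?thesis using ln_one_minus_ge[of s] s by (subst pos_divide_le_eq) auto
qed

text \<open>The exponential is expanded and each moment is bounded by the embedding applied to
  \<open>g ^ k\<close>; the factorials cancel and a geometric series of ratio 1/2 remains, whence 68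
  is twice 34. For small \<open>s\<close> the exponent is bounded outright.\<close>

lemma bloch_exp_square_sum:
  fixes g :: "complex \<Rightarrow> complex" and w :: "'i \<Rightarrow> complex"
  assumes hol: "g holomorphic_on ball 0 1" and g0: "g 0 = 0" and B0: "B > 0"
    and B: "\<And>z. cmod z < 1 \<Longrightarrow> cmod (deriv g z) * (1 - (cmod z)\<^sup>2) \<le> B"
    and fin: "finite I"
    and w: "\<And>n. n \<in> I \<Longrightarrow> (cmod (w n))\<^sup>2 \<le> s" and s: "0 < s" "s < 1"
  defines "p \<equiv> \<lambda>n. 1 - (cmod (w n))\<^sup>2"
  assumes M: "\<And>m. m \<in> I \<Longrightarrow> (\<Sum>n\<in>I. p n * p m * kern (w n) (w m)) \<le> M"
    and M': "(\<Sum>n\<in>I. p n) \<le> M"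
  shows "(\<Sum>n\<in>I. exp (1 / (8 * B\<^sup>2) * (cmod (g (w n)))\<^sup>2 / (- ln (1 - s))) * p n) \<le> 68 * M"
proof -
  define L where "L = - ln (1 - s)"
  have sL: "s \<le> L" using ln_one_minus_ge[of s] s by (simp add: L_def)
  have L0: "L > 0" using sL s by simp
  have p0: "p n \<ge> 0" if "n \<in> I" for n using w[OF that] s by (simp add: p_def)
  have M0: "M \<ge> 0" using M' sum_nonneg[of I p] p0 by auto
  show ?thesis
  proof (cases "s < 1/3")
    case True
    have "exp (1 / (8 * B\<^sup>2) * (cmod (g (w n)))\<^sup>2 / L) \<le> exp 1" if "n \<in> I" for n
    proof -
      have "1 / (8 * B\<^sup>2) * ((cmod (g (w n)))\<^sup>2 / L) \<le> 1 / (8 * B\<^sup>2) * (B / (1 - s))\<^sup>2"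
        unfolding L_def using bloch_square_le_log[OF hol g0 B0 B w[OF that] s] by (intro mult_left_mono) auto
      also have "\<dots> = 1 / (8 * (1 - s)\<^sup>2)" using B0 by (simp add: power_divide)
      also have "\<dots> \<le> 1"
      proof -
        have "(2/3)\<^sup>2 \<le> (1 - s)\<^sup>2" using True by (intro power_mono) auto
        then have "8 * (1 - s)\<^sup>2 \<ge> 1" by (simp add: power2_eq_square)
        then show ?thesis using divide_le_eq_1_pos[of "8 * (1 - s)\<^sup>2" 1] by linarith
      qed
      finally show ?thesis by simp
    qed
    then have "(\<Sum>n\<in>I. exp (1 / (8 * B\<^sup>2) * (cmod (g (w n)))\<^sup>2 / L) * p n) \<le> (\<Sum>n\<in>I. exp 1 * p n)"
      using p0 by (intro sum_mono mult_right_mono) auto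
    also have "\<dots> \<le> exp 1 * M" using M' by (simp add: sum_distrib_left[symmetric])
    also have "\<dots> \<le> 68 * M" using exp_le M0 by (intro mult_right_mono) auto
    finally show ?thesis by (simp add: L_def)
  next
    case False
    define R where "R = (1 + s) / 2"
    define l where "l = - ln (1 - R)"
    have R: "0 \<le> R" "R < 1" using s by (auto simp: R_def)
    \<comment> \<open>Passing from \<open>s\<close> to \<open>R\<close> halves \<open>1 - s\<close>
      and adds \<open>ln 2\<close> to the logarithm. Since \<open>s \<ge> 1/3\<close>, this is at
      most \<open>3 * L\<close>; hence the threshold of the case distinction.\<close>
    have "1 - R = (1 - s) / 2" by (simp add: R_def field_simps)
    then have "l = - ln ((1 - s) / 2)" by (simp only: l_def)
    also have "\<dots> = L + ln 2" using s ln_div[of "1 - s" 2] by (simp add: L_def)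
    finally have "l = L + ln 2" .
    then have l: "l \<le> 4 * L" using ln_2_less_1 False sL by simp
    have l0: "l \<ge> 0" using R by (simp add: l_def)
    have mom: "(\<Sum>n\<in>I. p n * (cmod (g (w n)))\<^sup>2 ^ k) \<le> 34 * M * (fact k * B ^ (2 * k) * l ^ k)" for k
    proof -
      have "(\<lambda>z. g z ^ k) holomorphic_on ball 0 1" using hol by (intro holomorphic_intros)
      from disc_power_series[OF this]
      obtain c where c: "\<And>z. cmod z < 1 \<Longrightarrow> (\<lambda>j. c j * z ^ j) sums (g z ^ k)"
        by blast
      have w1: "cmod (w n) < 1" if "n \<in> I" for n
        using w[OF that] s by (intro power2_less_imp_less[of _ 1]) auto
      have "(\<Sum>n\<in>I. p n * (cmod (g (w n) ^ k))\<^sup>2) \<le> 34 * M * (\<Sum>j. (cmod (c j))\<^sup>2 * R ^ j)"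
        unfolding p_def R_def using s R
        by (intro carleson_embedding[OF fin w _ s(2) M[unfolded p_def] M'[unfolded p_def]] c w1
            summable_coeff_square[OF c]) (auto simp: R_def)
      also have "\<dots> \<le> 34 * M * (fact k * B ^ (2 * k) * l ^ k)"
        unfolding l_def using M0 by (intro mult_left_mono bloch_power_moments[OF hol g0 B R c]) auto
      finally show ?thesis by (simp add: norm_power power_mult[symmetric] mult.commute)
    qed
    define y where "y n = 1 / (8 * B\<^sup>2) * (cmod (g (w n)))\<^sup>2 / L" for n
    have S: "(\<lambda>k. \<Sum>n\<in>I. p n * (y n ^ k /\<^sub>R fact k)) sums (\<Sum>n\<in>I. p n * exp (y n))"
      by (intro sums_sum sums_mult exp_converges)
    have T: "(\<lambda>k. 34 * M * (1/2) ^ k) sums (34 * M * 2)"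
      using sums_mult[OF geometric_sums[of "1/2::real"], of "34 * M"] by simp
    have "(\<Sum>n\<in>I. p n * (y n ^ k /\<^sub>R fact k)) \<le> 34 * M * (1/2) ^ k" for k
    proof -
      have "(\<Sum>n\<in>I. p n * (y n ^ k /\<^sub>R fact k)) = (1 / (8 * B\<^sup>2 * L)) ^ k / fact k * (\<Sum>n\<in>I. p n * (cmod (g (w n)))\<^sup>2 ^ k)"
        unfolding sum_distrib_left
      proof (intro sum.cong refl)
        fix n
        have "y n = 1 / (8 * B\<^sup>2 * L) * (cmod (g (w n)))\<^sup>2" by (simp add: y_def)
        then have "y n ^ k = (1 / (8 * B\<^sup>2 * L)) ^ k * (cmod (g (w n)))\<^sup>2 ^ k"
          by (simp only: power_mult_distrib)
        then show "p n * (y n ^ k /\<^sub>R fact k) = (1 / (8 * B\<^sup>2 * L)) ^ k / fact k * (p n * (cmod (g (w n)))\<^sup>2 ^ k)"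
          by (simp only: real_scaleR_def divide_inverse mult_ac)
      qed
      also have "\<dots> \<le> (1 / (8 * B\<^sup>2 * L)) ^ k / fact k * (34 * M * (fact k * B ^ (2 * k) * l ^ k))"
        using L0 by (intro mult_left_mono mom) auto
      also have "\<dots> = 34 * M * (l / (8 * L)) ^ k"
        using B0 by (simp add: power_mult power_mult_distrib power_divide)
      also have "\<dots> \<le> 34 * M * (1/2) ^ k"
        using l l0 L0 M0 by (intro mult_left_mono power_mono) (auto simp: divide_le_eq)
      finally show ?thesis .
    qed
    from sums_le[OF this S T] have "(\<Sum>n\<in>I. p n * exp (y n)) \<le> 68 * M" by simp
    then show ?thesis by (simp add: y_def L_def mult.commute)
  qed
qed

subsection \<open>Moebius invariance\<close>

lemma one_minus_pseudo_hyp_sq: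
  assumes "cmod z < 1" "cmod w < 1"
  shows "1 - (pseudo_hyp z w)\<^sup>2 = (1 - (cmod z)\<^sup>2) * (1 - (cmod w)\<^sup>2) * kern z w"
proof -
  have "(cmod (1 - cnj w * z))\<^sup>2 > 0" using one_minus_pos[OF assms] by simp
  then show ?thesis
    using cmod_one_minus_sq[of w z]
    by (simp add: pseudo_hyp_def kern_def norm_divide power_divide norm_minus_commute field_simps)
qed

text \<open>The disc automorphism exchanging 0 and \<open>a\<close>. It is its own inverse, so one
  map serves for both directions of the transport.\<close>

definition disc_inv :: "complex \<Rightarrow> complex \<Rightarrow> complex" where
  "disc_inv a z = (a - z) / (1 - cnj a * z)"

lemma cmod_disc_inv:
  assumes "cmod a < 1" "cmod z < 1"
  shows "1 - (cmod (disc_inv a z))\<^sup>2 = 1 - (pseudo_hyp a z)\<^sup>2"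
    and "1 - (cmod (disc_inv a z))\<^sup>2 = (1 - (cmod a)\<^sup>2) * (1 - (cmod z)\<^sup>2) * kern z a"
    and "cmod (disc_inv a z) < 1"
proof -
  have "cmod (disc_inv a z) = pseudo_hyp z a" by (simp add: disc_inv_def pseudo_hyp_def)
  then show 2: "1 - (cmod (disc_inv a z))\<^sup>2 = (1 - (cmod a)\<^sup>2) * (1 - (cmod z)\<^sup>2) * kern z a"
    using one_minus_pseudo_hyp_sq[OF assms(2,1)] by (simp add: mult_ac)
  then show "1 - (cmod (disc_inv a z))\<^sup>2 = 1 - (pseudo_hyp a z)\<^sup>2"
    using one_minus_pseudo_hyp_sq[OF assms] by (simp add: kern_sym)
  have "(cmod a)\<^sup>2 < 1" "(cmod z)\<^sup>2 < 1" using assms by (auto simp: power_less_one_iff abs_square_less_1)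
  moreover have "kern z a > 0" using one_minus_pos[OF assms(2,1)] unfolding kern_def by simp
  ultimately have "(1 - (cmod a)\<^sup>2) * (1 - (cmod z)\<^sup>2) * kern z a > 0" by simp
  then have "(cmod (disc_inv a z))\<^sup>2 < 1\<^sup>2" unfolding 2[symmetric] by simp
  then show "cmod (disc_inv a z) < 1" by (rule power2_less_imp_less) simp
qed

lemma disc_inv_involution:
  assumes "cmod a < 1" "cmod z < 1"
  shows "disc_inv a (disc_inv a z) = z"
proof -
  have 1: "1 - cnj a * z \<noteq> 0" using one_minus_pos[OF assms(2,1)] by auto
  have 2: "1 - cnj a * a \<noteq> 0" using one_minus_pos[OF assms(1,1)] by auto
  have "a - disc_inv a z = (1 - cnj a * a) * z / (1 - cnj a * z)"
    using 1 by (simp add: disc_inv_def field_simps)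
  moreover have "1 - cnj a * disc_inv a z = (1 - cnj a * a) / (1 - cnj a * z)"
    using 1 by (simp add: disc_inv_def field_simps)
  ultimately show ?thesis using 1 2 by (simp add: disc_inv_def[of a "disc_inv a z"])
qed

text \<open>This is Moebius invariance of the pseudo-hyperbolic distance, as each side is one minus
  its square. It carries the Carleson sums over to the transported points.\<close>

lemma kern_disc_inv:
  assumes "cmod a < 1" "cmod z < 1" "cmod w < 1"
  shows "(1 - (cmod (disc_inv a z))\<^sup>2) * (1 - (cmod (disc_inv a w))\<^sup>2) * kern (disc_inv a z) (disc_inv a w)
    = (1 - (cmod z)\<^sup>2) * (1 - (cmod w)\<^sup>2) * kern z w"
proof -
  have nz: "1 - cnj a * z \<noteq> 0" "1 - a * cnj w \<noteq> 0"
    using one_minus_pos[OF assms(2,1)] one_minus_pos[OF assms(1,3)] by (auto simp: mult.commute)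
  have a: "1 - (cmod a)\<^sup>2 \<noteq> 0" using power_less_one_iff[of "cmod a" 2] assms(1) by simp
  have "1 - cnj (disc_inv a w) * disc_inv a z = (1 - cnj a * a) * (1 - cnj w * z) / ((1 - a * cnj w) * (1 - cnj a * z))"
  proof -
    have "1 - cnj (disc_inv a w) * disc_inv a z
        = ((1 - a * cnj w) * (1 - cnj a * z) - (cnj a - cnj w) * (a - z)) / ((1 - a * cnj w) * (1 - cnj a * z))"
    proof -
      have "1 - x / y * (x' / y') = (y * y' - x * x') / (y * y')" if "y \<noteq> 0" "y' \<noteq> 0" for x y x' y' :: complex
        using that by (simp add: diff_divide_distrib)
      moreover have "cnj (disc_inv a w) = (cnj a - cnj w) / (1 - a * cnj w)" by (simp add: disc_inv_def)
      ultimately show ?thesis using nz by (simp only: disc_inv_def[of a z])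
    qed
    also have "(1 - a * cnj w) * (1 - cnj a * z) - (cnj a - cnj w) * (a - z) = (1 - cnj a * a) * (1 - cnj w * z)"
      by (simp add: algebra_simps)
    finally show ?thesis .
  qed
  moreover have "1 - cnj a * a = of_real (1 - (cmod a)\<^sup>2)"
    using complex_norm_square[of a] by (simp add: mult.commute)
  ultimately have "cmod (1 - cnj (disc_inv a w) * disc_inv a z)
      = \<bar>1 - (cmod a)\<^sup>2\<bar> * cmod (1 - cnj w * z) / (cmod (1 - cnj w * a) * cmod (1 - cnj a * z))"
    by (simp only: norm_mult norm_divide norm_of_real mult.commute[of a])
  then have k: "kern (disc_inv a z) (disc_inv a w) = kern z w / ((1 - (cmod a)\<^sup>2)\<^sup>2 * kern a w * kern z a)"
    by (simp add: kern_def power_mult_distrib power_divide)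
  have "kern a w > 0" "kern z a > 0"
    using one_minus_pos[OF assms(1,3)] one_minus_pos[OF assms(2,1)] by (auto simp: kern_def)
  then show ?thesis
    unfolding k cmod_disc_inv(2)[OF assms(1,2)] cmod_disc_inv(2)[OF assms(1,3)] kern_sym[of w a]
    using a by (simp add: power2_eq_square)
qed

text \<open>Conformal invariance of the Bloch seminorm: the derivative of \<open>disc_inv a\<close>
  has modulus \<open>(1 - (cmod (disc_inv a z))\<^sup>2) / (1 - (cmod z)\<^sup>2)\<close>. The same
  \<open>B\<close> serves for every base point, which makes the final estimates uniform.\<close>

lemma bloch_pullback:
  assumes hol: "b holomorphic_on ball 0 1"
    and B: "\<And>z. cmod z < 1 \<Longrightarrow> cmod (deriv b z) * (1 - (cmod z)\<^sup>2) \<le> B"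
    and a: "cmod a < 1"
  defines "g \<equiv> \<lambda>z. b (disc_inv a z) - b a"
  shows "g holomorphic_on ball 0 1" and "g 0 = 0"
    and "cmod z < 1 \<Longrightarrow> cmod (deriv g z) * (1 - (cmod z)\<^sup>2) \<le> B"
    and "cmod z < 1 \<Longrightarrow> g (disc_inv a z) = b z - b a"
proof -
  have der: "(g has_field_derivative deriv b (disc_inv a z) * ((cnj a * a - 1) / (1 - cnj a * z)\<^sup>2)) (at z)"
    if z: "cmod z < 1" for z
  proof -
    have nz: "1 - cnj a * z \<noteq> 0" using one_minus_pos[OF z a] by auto
    have "(disc_inv a has_field_derivative (cnj a * a - 1) / (1 - cnj a * z)\<^sup>2) (at z)"
      unfolding disc_inv_def using nz
      by (auto intro!: derivative_eq_intros simp: field_simps power2_eq_square)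
    moreover have "(b has_field_derivative deriv b (disc_inv a z)) (at (disc_inv a z))"
      using hol cmod_disc_inv(3)[OF a z] by (intro holomorphic_derivI[of _ "ball 0 1"]) auto
    ultimately have "((\<lambda>z. b (disc_inv a z)) has_field_derivative deriv b (disc_inv a z) * ((cnj a * a - 1) / (1 - cnj a * z)\<^sup>2)) (at z)"
      using DERIV_chain2 by blast
    from DERIV_diff[OF this DERIV_const[of "b a"]] show ?thesis by (simp add: g_def)
  qed
  show "g holomorphic_on ball 0 1"
    unfolding holomorphic_on_open[OF open_ball]
  proof
    fix z :: complex assume "z \<in> ball 0 1"
    then have "cmod z < 1" by simp
    from der[OF this] show "\<exists>f'. (g has_field_derivative f') (at z)" ..
  qed
  show "g 0 = 0" by (simp add: g_def disc_inv_def)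
  show "cmod (deriv g z) * (1 - (cmod z)\<^sup>2) \<le> B" if z: "cmod z < 1"
  proof -
    have "cnj a * a - 1 = of_real ((cmod a)\<^sup>2 - 1)"
      using complex_norm_square[of a] by (simp add: mult.commute)
    then have "cmod (cnj a * a - 1) = 1 - (cmod a)\<^sup>2"
      using a by (simp only: norm_of_real) (simp add: power_le_one)
    then have "cmod ((cnj a * a - 1) / (1 - cnj a * z)\<^sup>2) * (1 - (cmod z)\<^sup>2) = 1 - (cmod (disc_inv a z))\<^sup>2"
      unfolding cmod_disc_inv(2)[OF a z] by (simp add: norm_divide norm_power kern_def)
    then have "cmod (deriv g z) * (1 - (cmod z)\<^sup>2) = cmod (deriv b (disc_inv a z)) * (1 - (cmod (disc_inv a z))\<^sup>2)"
      unfolding DERIV_imp_deriv[OF der[OF z]] norm_mult by simp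
    then show ?thesis using B[OF cmod_disc_inv(3)[OF a z]] by simp
  qed
  show "g (disc_inv a z) = b z - b a" if "cmod z < 1"
    using disc_inv_involution[OF a that] by (simp add: g_def)
qed

text \<open>After transport by \<open>disc_inv a\<close>, the two bounds by \<open>M\<close> asked
  for in \<open>bloch_exp_square_sum\<close> are the Carleson condition at the points
  \<open>zs m\<close> and at \<open>a\<close>.\<close>

lemma bloch_carleson_finite_sum:
  fixes zs :: "'i \<Rightarrow> complex"
  assumes hol: "b holomorphic_on ball 0 1" and B0: "B > 0"
    and B: "\<And>z. cmod z < 1 \<Longrightarrow> cmod (deriv b z) * (1 - (cmod z)\<^sup>2) \<le> B"
    and zs: "\<And>n. cmod (zs n) < 1"
    and fin: "finite I"
    and M: "\<And>z. cmod z < 1 \<Longrightarrow> (\<Sum>n\<in>I. 1 - (pseudo_hyp z (zs n))\<^sup>2) \<le> M"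
    and a: "cmod a < 1" and s: "0 < s" "s < 1"
    and I: "\<And>n. n \<in> I \<Longrightarrow> (pseudo_hyp a (zs n))\<^sup>2 \<le> s"
  shows "(\<Sum>n\<in>I. exp (1 / (8 * B\<^sup>2) * (cmod (b (zs n) - b a))\<^sup>2 / (- ln (1 - s))) * (1 - (pseudo_hyp a (zs n))\<^sup>2)) \<le> 68 * M"
proof -
  define w where "w n = disc_inv a (zs n)" for n
  note pb = bloch_pullback[OF hol B a]
  have p: "1 - (cmod (w n))\<^sup>2 = 1 - (pseudo_hyp a (zs n))\<^sup>2" for n
    unfolding w_def by (rule cmod_disc_inv(1)[OF a zs])
  have k: "(1 - (cmod (w n))\<^sup>2) * (1 - (cmod (w m))\<^sup>2) * kern (w n) (w m) = 1 - (pseudo_hyp (zs m) (zs n))\<^sup>2" for n m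
    unfolding w_def kern_disc_inv[OF a zs zs] one_minus_pseudo_hyp_sq[OF zs zs] by (simp add: kern_sym mult_ac)
  have "(\<Sum>n\<in>I. exp (1 / (8 * B\<^sup>2) * (cmod (b (disc_inv a (w n)) - b a))\<^sup>2 / (- ln (1 - s))) * (1 - (cmod (w n))\<^sup>2)) \<le> 68 * M"
  proof (rule bloch_exp_square_sum[OF pb(1,2) B0 pb(3) fin _ s])
    show "(cmod (w n))\<^sup>2 \<le> s" if "n \<in> I" for n using I[OF that] p[of n] by simp
    show "(\<Sum>n\<in>I. (1 - (cmod (w n))\<^sup>2) * (1 - (cmod (w m))\<^sup>2) * kern (w n) (w m)) \<le> M" for m
      unfolding k by (rule M[OF zs])
    show "(\<Sum>n\<in>I. 1 - (cmod (w n))\<^sup>2) \<le> M" unfolding p by (rule M[OF a])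
  qed
  then show ?thesis unfolding p by (simp add: w_def disc_inv_involution[OF a zs])
qed

text \<open>For the transported point \<open>w\<close>, the choice
  \<open>s = (cmod w)\<^sup>2\<close> makes \<open>1 - s\<close> equal to \<open>p\<close>; it is
  positive because \<open>z\<close> differs from \<open>a\<close>.\<close>

lemma bloch_diff_le_near:
  assumes hol: "b holomorphic_on ball 0 1" and B0: "B > 0"
    and B: "\<And>z. cmod z < 1 \<Longrightarrow> cmod (deriv b z) * (1 - (cmod z)\<^sup>2) \<le> B"
    and z: "cmod z < 1" and a: "cmod a < 1" and ne: "z \<noteq> a"
  defines "p \<equiv> 1 - (pseudo_hyp a z)\<^sup>2"
  shows "(cmod (b z - b a))\<^sup>2 / (- ln p) \<le> (B / p)\<^sup>2"
proof -
  note pb = bloch_pullback[OF hol B a]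
  define w where "w = disc_inv a z"
  have p: "1 - (cmod w)\<^sup>2 = p" unfolding w_def p_def by (rule cmod_disc_inv(1)[OF a z])
  have "w \<noteq> 0" using ne one_minus_pos[OF z a] by (auto simp: w_def disc_inv_def)
  moreover have "(cmod w)\<^sup>2 < 1"
    using cmod_disc_inv(3)[OF a z] by (simp add: w_def abs_square_less_1)
  ultimately have "(cmod (b (disc_inv a w) - b a))\<^sup>2 / (- ln (1 - (cmod w)\<^sup>2)) \<le> (B / (1 - (cmod w)\<^sup>2))\<^sup>2"
    by (intro bloch_square_le_log[OF pb(1,2) B0 pb(3)]) auto
  then show ?thesis unfolding p by (simp add: w_def disc_inv_involution[OF a z])
qed

subsection \<open>The weak-type estimate\<close>

lemma dyadic_interval:
  fixes p T :: real
  assumes "0 < p" "p \<le> T"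
  obtains j where "(1/2) ^ Suc j * T < p" "p \<le> (1/2) ^ j * T"
proof -
  have T: "T > 0" using assms by simp
  obtain n where "(1/2) ^ n < p / T"
    using real_arch_pow_inv[of "p / T" "1/2"] assms T by auto
  then have "(1/2) ^ n * T < p" using T by (simp add: field_simps)
  moreover have "\<not> (1/2) ^ 0 * T < p" using assms by simp
  ultimately obtain k where "\<forall>i\<le>k. \<not> (1/2) ^ i * T < p" "(1/2) ^ (k + 1) * T < p"
    using ex_least_nat_less[of "\<lambda>k. (1/2) ^ k * T < p" n] by auto
  then show ?thesis by (intro that[of k]) (auto simp: not_less)
qed

text \<open>The constant 32 leaves room for two doublings before the 8 of the sum estimate is
  reached: one from squaring the exponential factor, one from replacing \<open>- ln (p n)\<close> by
  a common value on each shell. The constant 140 collects 1, 3 and 136 from the three classes of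
  points.\<close>

lemma bloch_carleson_finite_card:
  fixes zs :: "'i \<Rightarrow> complex"
  assumes hol: "b holomorphic_on ball 0 1" and B0: "B > 0"
    and B: "\<And>z. cmod z < 1 \<Longrightarrow> cmod (deriv b z) * (1 - (cmod z)\<^sup>2) \<le> B"
    and zs: "\<And>n. cmod (zs n) < 1"
    and fin: "finite I"
    and M: "\<And>z J. cmod z < 1 \<Longrightarrow> finite J \<Longrightarrow> (\<Sum>n\<in>J. 1 - (pseudo_hyp z (zs n))\<^sup>2) \<le> M"
    and a: "cmod a < 1" and t: "t > 0"
    and I: "\<And>n. n \<in> I \<Longrightarrow> t < (if zs n = a then 1 else exp (1 / (32 * B\<^sup>2) * (cmod (b (zs n) - b a))\<^sup>2
      / (- ln (1 - (pseudo_hyp a (zs n))\<^sup>2)))) * (1 - (pseudo_hyp a (zs n))\<^sup>2)"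
  shows "real (card I) \<le> 140 * M / t"
proof -
  define p where "p n = 1 - (pseudo_hyp a (zs n))\<^sup>2" for n
  define d where "d n = (cmod (b (zs n) - b a))\<^sup>2" for n
  define h where "h n = (if zs n = a then 1 else exp (1 / (32 * B\<^sup>2) * d n / (- ln (p n))))" for n
  have th: "t < h n * p n" if "n \<in> I" for n using I[OF that] unfolding h_def p_def d_def .
  have p0: "p n > 0" for n
  proof -
    have "cmod (disc_inv a (zs n)) < 1" by (rule cmod_disc_inv(3)[OF a zs])
    then show ?thesis
      unfolding p_def cmod_disc_inv(1)[OF a zs, symmetric] by (simp add: abs_square_less_1)
  qed
  have M0: "M \<ge> 0" using M[OF a, of "{}"] by simp
  have sp: "(\<Sum>n\<in>J. p n) \<le> M" if "finite J" for J unfolding p_def by (rule M[OF a that])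
  define I1 where "I1 = {n \<in> I. p n > t}"
  define I2 where "I2 = {n \<in> I. p n \<ge> 1/4}"
  define I3 where "I3 = {n \<in> I. p n \<le> min t (1/4)}"
  have fins: "finite I1" "finite I2" "finite I3" using fin by (auto simp: I1_def I2_def I3_def)
  have I1: "real (card I1) * t \<le> M"
  proof -
    have "real (card I1) * t = (\<Sum>n\<in>I1. t)" by simp
    also have "\<dots> \<le> (\<Sum>n\<in>I1. p n)" by (intro sum_mono) (auto simp: I1_def)
    finally show ?thesis using sp[OF fins(1)] by simp
  qed
  have I2: "real (card I2) * t \<le> 3 * M"
  proof -
    have h3: "h n \<le> 3" if n: "n \<in> I2" for n
    proof (cases "zs n = a")
      case False
      have "d n / (- ln (p n)) \<le> (B / p n)\<^sup>2"
        unfolding d_def p_def by (rule bloch_diff_le_near[OF hol B0 B zs a False])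
      also have "\<dots> \<le> (B / (1/4))\<^sup>2"
        using n B0 p0[of n] unfolding I2_def by (intro power_mono divide_left_mono) auto
      \<comment> \<open>Since \<open>p n \<ge> 1/4\<close>, the exponent is at most 1/2.\<close>
      finally have "1 / (32 * B\<^sup>2) * (d n / (- ln (p n))) \<le> 1 / (32 * B\<^sup>2) * (B / (1/4))\<^sup>2"
        by (intro mult_left_mono) auto
      also have "\<dots> \<le> 1" using B0 by (simp add: power_divide)
      finally have "h n \<le> exp 1" using False by (simp add: h_def)
      then show ?thesis using exp_le by linarith
    qed (simp add: h_def)
    have "real (card I2) * t = (\<Sum>n\<in>I2. t)" by simp
    also have "\<dots> \<le> (\<Sum>n\<in>I2. 3 * p n)"
    proof (intro sum_mono)
      fix n assume n: "n \<in> I2"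
      then have "t < h n * p n" by (intro th) (simp add: I2_def)
      also have "\<dots> \<le> 3 * p n" using h3[OF n] p0[of n] by (intro mult_right_mono) auto
      finally show "t \<le> 3 * p n" by simp
    qed
    also have "\<dots> \<le> 3 * M" using sp[OF fins(2)] by (simp add: sum_distrib_left[symmetric])
    finally show ?thesis .
  qed
  have I3: "real (card I3) * t \<le> 136 * M"
  proof -
    define T where "T = min t (1/4)"
    have T: "0 < T" "T \<le> t" "T \<le> 1/4" using t by (auto simp: T_def)
    have "\<exists>j. (1/2) ^ Suc j * T < p n \<and> p n \<le> (1/2) ^ j * T" if "n \<in> I3" for n
      using dyadic_interval[of "p n" T] p0[of n] that unfolding I3_def T_def by blast
    then obtain j where j: "\<And>n. n \<in> I3 \<Longrightarrow> (1/2) ^ Suc (j n) * T < p n"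
        "\<And>n. n \<in> I3 \<Longrightarrow> p n \<le> (1/2) ^ j n * T" by metis
    have group: "real (card {n \<in> I3. j n = i}) * t \<le> (1/2) ^ i * (68 * M)" for i
    proof -
      define G where "G = {n \<in> I3. j n = i}"
      have finG: "finite G" using fins by (simp add: G_def)
      \<comment> \<open>This is the lower end of the shell, so \<open>1 - q\<close> can play the
        part of \<open>s\<close>. As \<open>T \<le> 1/4\<close>, it is at most 1/8; then
        \<open>L \<ge> 3 * ln 2\<close>, and the loss of \<open>ln 2\<close> across the shell costs
        less than half of \<open>L\<close>.\<close>
      define q where "q = (1/2) ^ Suc i * T"
      define L where "L = - ln q"
      have "(1/2) ^ Suc i \<le> (1/2 :: real)" by (simp add: power_le_one)
      then have q: "0 < q" "q \<le> 1/8" unfolding q_def using T mult_mono[of "(1/2) ^ Suc i" "1/2" T "1/4"] by auto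
      have "ln q \<le> ln ((1/2) ^ 3)" using q by (subst ln_le_cancel_iff) (auto simp: power3_eq_cube)
      also have "\<dots> = - 3 * ln 2" by (subst ln_realpow) (auto simp: ln_div)
      finally have L3: "L \<ge> 3 * ln 2" by (simp add: L_def)
      have ln2: "ln (2::real) > 0" by simp
      have L0: "L > 0" using L3 ln2 by linarith
      have pq: "q < p n" "p n \<le> 2 * q" if "n \<in> G" for n
        using j[of n] that by (auto simp: G_def q_def)
      have Ln: "- ln (p n) \<ge> L / 2" if n: "n \<in> G" for n
      proof -
        have "ln (p n) \<le> ln (2 * q)" using pq[OF n] p0[of n] q by (subst ln_le_cancel_iff) auto
        also have "\<dots> = ln 2 - L" using q by (simp add: ln_mult L_def)
        finally show ?thesis using L3 ln2 by linarith
      qed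
      have h2: "(h n)\<^sup>2 \<le> exp (1 / (8 * B\<^sup>2) * d n / L)" if n: "n \<in> G" for n
      proof -
        have "- ln (p n) > 0" using Ln[OF n] L0 by linarith
        then have "d n / (- ln (p n)) \<le> d n / (L / 2)"
          using Ln[OF n] L0 by (intro divide_left_mono mult_pos_pos) (auto simp: d_def)
        then have "1 / (16 * B\<^sup>2) * (d n / (- ln (p n))) \<le> 1 / (16 * B\<^sup>2) * (d n / (L / 2))"
          by (intro mult_left_mono) auto
        also have "\<dots> = 1 / (8 * B\<^sup>2) * d n / L" by simp
        finally have le: "1 / (16 * B\<^sup>2) * (d n / (- ln (p n))) \<le> 1 / (8 * B\<^sup>2) * d n / L" .
        show ?thesis
        proof (cases "zs n = a")
          case True
          then show ?thesis using L0 by (simp add: h_def d_def)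
        next
          case False
          then have "(h n)\<^sup>2 = exp (1 / (16 * B\<^sup>2) * (d n / (- ln (p n))))"
            by (simp add: h_def exp_double[symmetric])
          then show ?thesis using le by simp
        qed
      qed
      have "(\<Sum>n\<in>G. exp (1 / (8 * B\<^sup>2) * (cmod (b (zs n) - b a))\<^sup>2 / (- ln (1 - (1 - q)))) * (1 - (pseudo_hyp a (zs n))\<^sup>2)) \<le> 68 * M"
      proof (rule bloch_carleson_finite_sum[OF hol B0 B zs finG _ a])
        show "(\<Sum>n\<in>G. 1 - (pseudo_hyp z (zs n))\<^sup>2) \<le> M" if "cmod z < 1" for z by (rule M[OF that finG])
        show "(pseudo_hyp a (zs n))\<^sup>2 \<le> 1 - q" if "n \<in> G" for n using pq[OF that] by (simp add: p_def)
      qed (use q in auto)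
      then have S: "(\<Sum>n\<in>G. exp (1 / (8 * B\<^sup>2) * d n / L) * p n) \<le> 68 * M"
        by (simp add: d_def p_def L_def)
      \<comment> \<open>Chebyshev's inequality for the square: one factor \<open>p n\<close> of
        \<open>(h n * p n)\<^sup>2\<close> is bounded by the upper end of the shell and provides the
        decay in \<open>i\<close>, the other remains as the weight in the sum estimate.\<close>
      have "real (card G) * t\<^sup>2 = (\<Sum>n\<in>G. t\<^sup>2)" by simp
      also have "\<dots> \<le> (\<Sum>n\<in>G. (1/2) ^ i * t * (exp (1 / (8 * B\<^sup>2) * d n / L) * p n))"
      proof (intro sum_mono)
        fix n assume n: "n \<in> G"
        then have "t < h n * p n" by (intro th) (auto simp: G_def I3_def)
        then have "t\<^sup>2 \<le> (h n * p n)\<^sup>2" using t by (intro power_mono) auto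
        also have "\<dots> = p n * ((h n)\<^sup>2 * p n)" by (simp add: power2_eq_square)
        also have "\<dots> \<le> ((1/2) ^ i * t) * (exp (1 / (8 * B\<^sup>2) * d n / L) * p n)"
        proof (rule mult_mono)
          have "p n \<le> (1/2) ^ i * T" using j(2)[of n] n by (auto simp: G_def)
          also have "\<dots> \<le> (1/2) ^ i * t" using T by (intro mult_left_mono) auto
          finally show "p n \<le> (1/2) ^ i * t" .
          show "(h n)\<^sup>2 * p n \<le> exp (1 / (8 * B\<^sup>2) * d n / L) * p n"
            using h2[OF n] p0[of n] by (intro mult_right_mono) auto
        qed (use t p0[of n] in auto)
        finally show "t\<^sup>2 \<le> (1/2) ^ i * t * (exp (1 / (8 * B\<^sup>2) * d n / L) * p n)" .
      qed
      also have "\<dots> \<le> (1/2) ^ i * t * (68 * M)"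
        unfolding sum_distrib_left[symmetric] using S t by (intro mult_left_mono) auto
      finally have "t * (real (card G) * t) \<le> t * ((1/2) ^ i * (68 * M))"
        by (simp add: power2_eq_square mult_ac)
      then show ?thesis unfolding G_def[symmetric] using t by (simp only: mult_le_cancel_left_pos)
    qed
    have "real (card I3) * t = (\<Sum>n\<in>I3. t)" by simp
    also have "\<dots> = (\<Sum>i\<in>j ` I3. \<Sum>n\<in>{n \<in> I3. j n = i}. t)"
      by (rule sum.image_gen[OF fins(3)])
    also have "\<dots> \<le> (\<Sum>i\<in>j ` I3. (1/2) ^ i * (68 * M))"
      using group by (intro sum_mono) simp
    also have "\<dots> \<le> (\<Sum>i. (1/2) ^ i * (68 * M))"
      using M0 fins by (intro sum_le_suminf summable_mult2 summable_geometric) auto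
    also have "\<dots> = 136 * M"
      using sums_mult2[OF geometric_sums[of "1/2::real"], of "68 * M"] by (simp add: sums_iff)
    finally show ?thesis .
  qed
  have "I \<subseteq> I1 \<union> I2 \<union> I3" by (auto simp: I1_def I2_def I3_def)
  then have "card I \<le> card (I1 \<union> I2 \<union> I3)" using fins by (intro card_mono) auto
  also have "\<dots> \<le> card I1 + card I2 + card I3"
    by (meson add_le_mono card_Un_le le_refl order_trans)
  finally have "real (card I) \<le> real (card I1) + real (card I2) + real (card I3)" by linarith
  then have "real (card I) * t \<le> (real (card I1) + real (card I2) + real (card I3)) * t"
    using t by (intro mult_right_mono) auto
  also have "\<dots> \<le> 140 * M" using I1 I2 I3 by (simp add: distrib_right)
  finally show ?thesis using t by (simp add: pos_le_divide_eq)
qed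

section \<open>Passage from finite index sets to the whole sequence\<close>

theorem theorem1p4:
  fixes b :: "complex \<Rightarrow> complex" and zs :: "nat \<Rightarrow> complex"
  assumes "bloch b"
    and "\<And>n. zs n \<in> ball 0 1"
    and "carleson_seq zs"
  shows "(\<exists>lam>(0::real). \<exists>M. \<forall>z\<in>ball 0 1. \<forall>r\<in>{0<..<1::real}.
            (\<lambda>n. exp (lam * (cmod (b (zs n) - b z))\<^sup>2 / (- ln (1 - r\<^sup>2)))
                   * (1 - (pseudo_hyp z (zs n))\<^sup>2)) summable_on {n. pseudo_hyp z (zs n) < r}
          \<and> (\<Sum>\<^sub>\<infinity>n\<in>{n. pseudo_hyp z (zs n) < r}.
                exp (lam * (cmod (b (zs n) - b z))\<^sup>2 / (- ln (1 - r\<^sup>2)))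
                   * (1 - (pseudo_hyp z (zs n))\<^sup>2)) \<le> M)
       \<and> (\<exists>lam>(0::real). \<exists>C>0. \<forall>z\<in>ball 0 1. \<forall>t>(0::real).
            finite {n. (if zs n = z then 1
                        else exp (lam * (cmod (b (zs n) - b z))\<^sup>2
                                  / (- ln (1 - (pseudo_hyp z (zs n))\<^sup>2))))
                       * (1 - (pseudo_hyp z (zs n))\<^sup>2) > t}
          \<and> real (card {n. (if zs n = z then 1
                        else exp (lam * (cmod (b (zs n) - b z))\<^sup>2
                                  / (- ln (1 - (pseudo_hyp z (zs n))\<^sup>2))))
                       * (1 - (pseudo_hyp z (zs n))\<^sup>2) > t}) \<le> C / t)"
proof -
  from assms(1) obtain B' where hol: "b holomorphic_on ball 0 1"
    and B': "\<And>z. z \<in> ball 0 1 \<Longrightarrow> cmod (deriv b z) * (1 - (cmod z)\<^sup>2) \<le> B'"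
    unfolding bloch_def by blast
  \<comment> \<open>The maximum with 1 makes the bound positive, so that \<open>B\<^sup>2\<close>
    may be divided by even when \<open>b\<close> is constant.\<close>
  define B where "B = max B' 1"
  have B0: "B > 0" by (simp add: B_def)
  have B: "cmod (deriv b z) * (1 - (cmod z)\<^sup>2) \<le> B" if "cmod z < 1" for z
    using B'[of z] that by (simp add: B_def)
  have zs: "cmod (zs n) < 1" for n using assms(2)[of n] by simp
  have p0: "1 - (pseudo_hyp z (zs n))\<^sup>2 \<ge> 0" if "cmod z < 1" for z n
    unfolding cmod_disc_inv(1)[OF that zs, symmetric]
    using cmod_disc_inv(3)[OF that zs, of n] by (simp add: power_le_one)
  from assms(3) obtain M where
    M': "\<forall>z\<in>ball 0 1. summable (\<lambda>n. 1 - (pseudo_hyp z (zs n))\<^sup>2) \<and>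
       (\<Sum>n. 1 - (pseudo_hyp z (zs n))\<^sup>2) \<le> M"
    unfolding carleson_seq_def by (elim exE)
  have M: "(\<Sum>n\<in>J. 1 - (pseudo_hyp z (zs n))\<^sup>2) \<le> M" if "cmod z < 1" "finite J" for z J
  proof -
    have "(\<Sum>n\<in>J. 1 - (pseudo_hyp z (zs n))\<^sup>2) \<le> (\<Sum>n. 1 - (pseudo_hyp z (zs n))\<^sup>2)"
      using M' that p0[OF that(1)] by (intro sum_le_suminf) auto
    also have "\<dots> \<le> M" using M' that(1) by simp
    finally show ?thesis .
  qed
  have M0: "M \<ge> 0" using M[of 0 "{}"] by simp
  show ?thesis
  proof (rule conjI, goal_cases)
    case 1
    show ?case
    proof (rule exI[of _ "1 / (8 * B\<^sup>2)"], rule conjI[rotated], rule exI[of _ "68 * M"], intro ballI conjI)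
      fix z :: complex and r :: real assume z: "z \<in> ball 0 1" and r: "r \<in> {0<..<1}"
      define f where "f n = exp (1 / (8 * B\<^sup>2) * (cmod (b (zs n) - b z))\<^sup>2 / (- ln (1 - r\<^sup>2)))
                     * (1 - (pseudo_hyp z (zs n))\<^sup>2)" for n
      let ?A = "{n. pseudo_hyp z (zs n) < r}"
      have f0: "f n \<ge> 0" for n unfolding f_def using p0[of z n] z by simp
      have bd: "sum f J \<le> 68 * M" if J: "finite J" "J \<subseteq> ?A" for J
        unfolding f_def
      proof (rule bloch_carleson_finite_sum[OF hol B0 B zs J(1)])
        show "(pseudo_hyp z (zs n))\<^sup>2 \<le> r\<^sup>2" if "n \<in> J" for n
          using that J(2) by (intro power_mono) (auto simp: pseudo_hyp_def)
      qed (use z r M J in \<open>auto simp: abs_square_less_1\<close>)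
      \<comment> \<open>The terms are nonnegative and the finite sums have a common bound, so the
        infinite sum exists with the same bound.\<close>
      have sm: "f summable_on ?A"
        using f0 bd by (intro nonneg_bdd_above_summable_on bdd_aboveI2[where M = "68 * M"]) auto
      then show "f summable_on ?A" .
      show "infsum f ?A \<le> 68 * M" by (rule infsum_le_finite_sums[OF sm bd])
    qed (use B0 in simp)
  next
    case 2
    show ?case
    \<comment> \<open>The added 1 keeps the constant positive when \<open>M = 0\<close>.\<close>
    proof (rule exI[of _ "1 / (32 * B\<^sup>2)"], rule conjI[rotated], rule exI[of _ "140 * M + 1"],
        rule conjI[rotated], intro ballI allI impI conjI)
      fix z :: complex and t :: real assume z: "z \<in> ball 0 1" and t: "t > 0"
      define S where "S = {n. t < (if zs n = z then 1
                          else exp (1 / (32 * B\<^sup>2) * (cmod (b (zs n) - b z))\<^sup>2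
                                    / (- ln (1 - (pseudo_hyp z (zs n))\<^sup>2))))
                         * (1 - (pseudo_hyp z (zs n))\<^sup>2)}"
      have bd: "real (card J) \<le> 140 * M / t" if "finite J" "J \<subseteq> S" for J
        using that z t by (intro bloch_carleson_finite_card[OF hol B0 B zs _ M]) (auto simp: S_def)
      \<comment> \<open>An infinite set would have finite subsets of every size, so the uniform
        bound on their cardinalities forces \<open>S\<close> to be finite.\<close>
      have "card J \<le> nat \<lfloor>140 * M / t\<rfloor>" if "finite J" "J \<subseteq> S" for J
        using bd[OF that] by (simp add: le_nat_floor)
      then show fin: "finite S" using finite_if_finite_subsets_card_bdd[of S] by blast
      have "real (card S) \<le> 140 * M / t" by (rule bd[OF fin order_refl])
      also have "\<dots> \<le> (140 * M + 1) / t" using t by (intro divide_right_mono) auto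
      finally show "real (card S) \<le> (140 * M + 1) / t" .
    qed (use B0 M0 in auto)
  qed
qed

end
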